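(* Let $-\infty\le a<b\le\infty$ be such that $F(b\,-)>F(a)$ and $\hat F_n(x)\to_p F(x)$ for any fixed $x\in(a,b)$. For $\delta>0$ let $C_\delta$ be the set of all real $x\in[a,b]$ such that $f(x)>0$ or $f$ is continuous on $(x-\delta,x+\delta)$. Further let $D_\delta$ be the set of all real $x\in[a,b]$ such that $1_{(a,b)}f$ is continuous on $(x-\delta,x+\delta)$. Then for any fixed $\delta>0$, $$\sup_{x\in C_\delta}\bigl(\hat f_n(x)-f(x)\bigr)^+\to_p0\quad\text{and}\quad\sup_{x\in D_\delta}\bigl|\hat f_n(x)-f(x)\bigr|\to_p0.$$ Moreover, $$\int_a^b\bigl|\hat f_n(x)-f(x)\bigr|\,dx\to_p0\quad\text{and}\quad\sup_{x\in[a,b]}\bigl|\hat F_n(x)-F(x)\bigr|\to_p0.$$ Finally, if $b=\infty$, then $\hat q_n\to_p q$. Otherwise (if $b<\infty$): $$\hat q_n\le 1-F(b)+o_p(1);$$ $$\hat q_n=1-F(b)+o_p(1)\quad\text{if } f(b)=0;$$ $$\hat q_n\ge 1-F(b)-f(b)/|\phi'(b\,-)|+o_p(1)\quad\text{if } f(b)>0>\phi'(b\,-).$$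
   Context: Parameter space: $\Theta$ is the set of all pairs $(\phi,q)$ with $q\in[0,1)$ and $\phi:\mathbb R\to[-\infty,\infty)$ concave and upper semicontinuous such that $\int_{\mathbb R} e^{\phi(x)}\,dx+q=1$. For Borel $B\subset(-\infty,\infty]$, $P_{\phi,q}(B)=\int_{B\cap\mathbb R} e^{\phi(x)}\,dx+1_{[\infty\in B]}\,q$. Setting: $P=P_{\phi,q}$ for a fixed $(\phi,q)\in\Theta$ is the true distribution, $f=e^\phi$. For each $n$, $(\hat\phi_n,\hat q_n)$ is a random element of $\Theta$, namely a maximum-likelihood estimator of $(\phi,q)$ based on $n$ censored observations $\widetilde X_1,\dots,\widetilde X_n$ (not necessarily purely interval-censored): each $\widetilde X_i$ contains $X_i\sim P$ and is either an interval $(L_i,R_i]$ with $-\infty<L_i<R_i\le\infty$ or a single point $L_i=R_i=X_i\in\mathbb R$, and $(\hat\phi_n,\hat q_n)$ maximizes over $\Theta$ $$\ell(\psi,r)=\frac1n\sum_{i=1}^n\Bigl(1_{[L_i=R_i]}\psi(X_i)+1_{[L_i<R_i]}\log P_{\psi,r}((L_i,R_i])\Bigr).$$ Put $\hat f_n=e^{\hat\phi_n}$ and $\hat P_n=P_{\hat\phi_n,\hat q_n}$; $F,\hat F_n:[-\infty,\infty]\to[0,1]$ are the distribution functions of $P$ and $\hat P_n$ (so $F(-\infty)=0$, $F(\infty)=1$, $F(\infty\,-)=1-q$). Notation: $s^+=\max\{s,0\}$; $g(b\,-)$ denotes a left limit and $\phi'(b\,-)$ the left-sided derivative (possibly $-\infty$,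 in which case $f(b)/|\phi'(b\,-)|=0$). Asymptotics are as $n\to\infty$; $\to_p$ is convergence in probability; "$U_n\le c+o_p(1)$" means $(U_n-c)^+\to_p0$, "$U_n\ge c+o_p(1)$" means $(c-U_n)^+\to_p0$, "$U_n=c+o_p(1)$" means $U_n\to_p c$. *)

theory Defs
  imports "HOL-Probability.Probability"
begin

section \<open>Parameter space and the distributions \<open>P_{\<phi>,q}\<close>\<close>

text \<open>A function \<open>\<real> \<rightarrow> [-\<infinity>,\<infinity>)\<close> is a map \<open>real \<Rightarrow> ereal\<close> that omits the value \<open>\<infinity>\<close>; for such
  functions the sum below is never of the form \<open>\<infinity> - \<infinity>\<close>.\<close>

definition concave_ext :: "(real \<Rightarrow> ereal) \<Rightarrow> bool" where
  "concave_ext \<phi> \<longleftrightarrow>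
     (\<forall>x y. \<forall>t\<in>{0<..<1}. ereal (1 - t) * \<phi> x + ereal t * \<phi> y \<le> \<phi> ((1 - t) * x + t * y))"

definition upper_semicont :: "(real \<Rightarrow> ereal) \<Rightarrow> bool" where
  "upper_semicont \<phi> \<longleftrightarrow> (\<forall>x. Limsup (at x) \<phi> \<le> \<phi> x)"

text \<open>\<open>exp\<close> on \<open>[-\<infinity>,\<infinity>)\<close> and \<open>log\<close> on \<open>[0,1]\<close>, with \<open>exp (-\<infinity>) = 0\<close> and \<open>log 0 = -\<infinity>\<close>.\<close>

definition exp_ext :: "ereal \<Rightarrow> real" where
  "exp_ext s = (if s = -\<infinity> then 0 else exp (real_of_ereal s))"

definition log_ext :: "real \<Rightarrow> ereal" where
  "log_ext p = (if p = 0 then -\<infinity> else ereal (ln p))"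

definition dens :: "(real \<Rightarrow> ereal) \<Rightarrow> real \<Rightarrow> real" where
  "dens \<phi> x = exp_ext (\<phi> x)"

definition Theta :: "((real \<Rightarrow> ereal) \<times> real) set" where
  "Theta = {(\<phi>, q). 0 \<le> q \<and> q < 1 \<and> (\<forall>x. \<phi> x \<noteq> \<infinity>) \<and> concave_ext \<phi> \<and> upper_semicont \<phi> \<and>
              (\<integral>\<^sup>+ x. ennreal (dens \<phi> x) \<partial>lborel) + ennreal q = 1}"

text \<open>Only used for Borel sets \<open>B \<subseteq> (-\<infinity>,\<infinity>]\<close>.\<close>

definition Pr :: "(real \<Rightarrow> ereal) \<Rightarrow> real \<Rightarrow> ereal set \<Rightarrow> real" where
  "Pr \<phi> q B = (LINT x:{x. ereal x \<in> B}|lborel. dens \<phi> x) + indicator B \<infinity> * q"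

definition dist_fun :: "(real \<Rightarrow> ereal) \<Rightarrow> real \<Rightarrow> ereal \<Rightarrow> real" where
  "dist_fun \<phi> q x = Pr \<phi> q {-\<infinity><..x}"

text \<open>Left-sided derivative at a point where \<open>\<phi>\<close> is finite; the value may be \<open>-\<infinity>\<close>.\<close>

definition left_deriv :: "(real \<Rightarrow> ereal) \<Rightarrow> real \<Rightarrow> ereal" where
  "left_deriv \<phi> b = Lim (at_left b) (\<lambda>x. (\<phi> b - \<phi> x) / ereal (b - x))"


section \<open>Likelihood\<close>

text \<open>The \<open>i\<close>-th observation is given by its endpoints: the interval \<open>(L i, R i]\<close> if \<open>L i < R i\<close>,
  and the exact value \<open>X i = L i\<close> if \<open>L i = R i\<close>.\<close>

definition loglik ::
    "nat \<Rightarrow> (nat \<Rightarrow> real) \<Rightarrow> (nat \<Rightarrow> ereal) \<Rightarrow> (real \<Rightarrow> ereal) \<Rightarrow> real \<Rightarrow> ereal" where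
  "loglik n L R \<psi> r =
     (\<Sum>i<n. if ereal (L i) = R i then \<psi> (L i)
             else log_ext (Pr \<psi> r {ereal (L i)<..R i})) / ereal (real n)"

definition is_MLE ::
    "nat \<Rightarrow> (nat \<Rightarrow> real) \<Rightarrow> (nat \<Rightarrow> ereal) \<Rightarrow> (real \<Rightarrow> ereal) \<Rightarrow> real \<Rightarrow> bool" where
  "is_MLE n L R \<psi> r \<longleftrightarrow>
     (\<psi>, r) \<in> Theta \<and> (\<forall>(\<psi>', r')\<in>Theta. loglik n L R \<psi>' r' \<le> loglik n L R \<psi> r)"


section \<open>Convergence in probability\<close>

text \<open>For \<open>[0,\<infinity>]\<close>-valued \<open>U n\<close>, so that suprema over possibly empty index sets are
  meaningful (the supremum of the empty set is 0). The outer measure equals the measure on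
  measurable events; it keeps the notion from degenerating to a void one in case the
  event has not been shown to be measurable.\<close>

definition to_prob_zero :: "'w measure \<Rightarrow> (nat \<Rightarrow> 'w \<Rightarrow> ennreal) \<Rightarrow> bool" where
  "to_prob_zero M U \<longleftrightarrow>
     (\<forall>\<epsilon>>0. (\<lambda>n. outer_measure_of M {\<omega>\<in>space M. U n \<omega> > \<epsilon>}) \<longlonglongrightarrow> 0)"

definition pos_part :: "real \<Rightarrow> real" where
  "pos_part s = max s 0"

text \<open>\<open>U n \<rightarrow>\<^sub>p c\<close> (also written \<open>U n = c + o_p(1)\<close>), \<open>U n \<le> c + o_p(1)\<close> and
  \<open>U n \<ge> c + o_p(1)\<close>, respectively.\<close>

definition to_prob :: "'w measure \<Rightarrow> (nat \<Rightarrow> 'w \<Rightarrow> real) \<Rightarrow> real \<Rightarrow> bool" where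
  "to_prob M U c \<longleftrightarrow> to_prob_zero M (\<lambda>n \<omega>. ennreal \<bar>U n \<omega> - c\<bar>)"

definition le_op1 :: "'w measure \<Rightarrow> (nat \<Rightarrow> 'w \<Rightarrow> real) \<Rightarrow> real \<Rightarrow> bool" where
  "le_op1 M U c \<longleftrightarrow> to_prob_zero M (\<lambda>n \<omega>. ennreal (pos_part (U n \<omega> - c)))"

definition ge_op1 :: "'w measure \<Rightarrow> (nat \<Rightarrow> 'w \<Rightarrow> real) \<Rightarrow> real \<Rightarrow> bool" where
  "ge_op1 M U c \<longleftrightarrow> to_prob_zero M (\<lambda>n \<omega>. ennreal (pos_part (c - U n \<omega>)))"


section \<open>The sets \<open>C_\<delta>\<close> and \<open>D_\<delta>\<close>\<close>

definition C_set :: "(real \<Rightarrow> real) \<Rightarrow> ereal \<Rightarrow> ereal \<Rightarrow> real \<Rightarrow> real set" where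
  "C_set f a b \<delta> = {x. a \<le> ereal x \<and> ereal x \<le> b \<and>
     (f x > 0 \<or> continuous_on {x - \<delta><..<x + \<delta>} f)}"

definition D_set :: "(real \<Rightarrow> real) \<Rightarrow> ereal \<Rightarrow> ereal \<Rightarrow> real \<Rightarrow> real set" where
  "D_set f a b \<delta> = {x. a \<le> ereal x \<and> ereal x \<le> b \<and>
     continuous_on {x - \<delta><..<x + \<delta>} (\<lambda>y. indicator (einterval a b) y * f y)}"

end

theory Submission
  imports Defs
begin

text \<open>The problem is deterministic: by a subsequence argument, closeness of \<open>Fh\<close> and \<open>F\<close> at finitely many
  points of \<open>(a,b)\<close> excludes a large deviation of any of the quantities in question.
  So let \<open>g k\<close> be log-concave with \<open>\<integral> g k \<rightarrow> \<integral> f\<close> over compact subintervals of \<open>(a,b)\<close>, and let \<open>(c,d)\<close> be the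
  interior of \<open>{f > 0} \<inter> (a,b)\<close>. Comparing values with averages over short neighbouring intervals yields
  locally uniform convergence on \<open>(c,d)\<close>. Outside, \<open>g k\<close> lies below the extensions of its log-linear chords:
  this bounds \<open>g k\<close> near \<open>c\<close> and \<open>d\<close>, and bounds its tails by exponential ones, where the rate
  tends to \<open>|\<phi>'(b -)|\<close> when the chords shrink towards a point \<open>b\<close> with \<open>f b > 0\<close>.\<close>

section \<open>Log-concave functions\<close>

text \<open>The behaviour at the right end \<open>d\<close> depends on whether \<open>f\<close>
  tends to 0 there and whether \<open>d < b\<close>. If \<open>f\<close> tends to 0, chords inside
  the support already make the tails of \<open>g k\<close> small. If \<open>d < b\<close>, the
  assumed convergence reaches beyond \<open>d\<close>, where \<open>f\<close> vanishes, and forces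
  \<open>g k\<close> down there. The obstacle is \<open>d = b\<close> with \<open>f b > 0\<close>:
  the hypotheses say nothing beyond \<open>b\<close>, mass of \<open>g k\<close> may persist there,
  and only the slope of \<open>ln f\<close> at \<open>b\<close> limits it. Hence the one-sided
  claims about \<open>qh\<close>. Near such a jump of \<open>f\<close> uniform convergence can fail
  as well; \<open>C_set\<close> and \<open>D_set\<close> keep a distance \<delta> from it, except
  that upper bounds still hold on its inner side. Log-concavity is stated with \<open>powr\<close>
  on real values: since \<open>0 powr t = 0\<close>, the inequality is void as soon as one value
  vanishes, so the value -\<infinity> of the exponent needs no separate treatment.\<close>

definition log_concave :: "(real \<Rightarrow> real) \<Rightarrow> bool" where
  "log_concave g \<longleftrightarrow> (\<forall>x. 0 \<le> g x) \<and>
     (\<forall>x y. \<forall>t\<in>{0<..<1}. g x powr (1 - t) * g y powr t \<le> g ((1 - t) * x + t * y))"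

lemma log_concave_nonneg: "log_concave g \<Longrightarrow> 0 \<le> g x"
  by (simp add: log_concave_def)

lemma log_concave_between:
  assumes g: "log_concave g" and xyz: "x < y" "y < z"
  shows "g x powr ((z - y) / (z - x)) * g z powr ((y - x) / (z - x)) \<le> g y"
proof -
  define t where "t = (y - x) / (z - x)"
  have t: "t \<in> {0<..<1}" using xyz by (auto simp: t_def field_simps)
  have e1: "1 - t = (z - y) / (z - x)" using xyz by (simp add: t_def field_simps)
  have "(1 - t) * x + t * z = x + t * (z - x)" by (simp add: algebra_simps)
  also have "\<dots> = y" using xyz by (simp add: t_def)
  finally have e2: "(1 - t) * x + t * z = y" .
  have "g x powr (1 - t) * g z powr t \<le> g ((1 - t) * x + t * z)"
    using g t unfolding log_concave_def by blast
  then show ?thesis unfolding e2 unfolding e1 unfolding t_def .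
qed

text \<open>A weighted geometric mean is at least the minimum. Read forwards, this carries lower
  bounds from two points to everything between them; read backwards, a small value to the right of a
  large one forces small values from there on.\<close>

lemma log_concave_min:
  assumes g: "log_concave g" and xyz: "x \<le> y" "y \<le> z"
  shows "min (g x) (g z) \<le> g y"
proof (cases "x < y \<and> y < z")
  case True
  define t where "t = (y - x) / (z - x)"
  have t: "0 < t" "t < 1" using True by (auto simp: t_def field_simps)
  have e1: "1 - t = (z - y) / (z - x)" using True by (simp add: t_def field_simps)
  define m where "m = min (g x) (g z)"
  have m: "0 \<le> m" "m \<le> g x" "m \<le> g z" using log_concave_nonneg[OF g] by (auto simp: m_def)
  have "m = m powr (1 - t) * m powr t"
    using m by (simp flip: powr_add)
  also have "\<dots> \<le> g x powr (1 - t) * g z powr t"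
    using m t by (intro mult_mono powr_mono2) auto
  also have "\<dots> \<le> g y"
    using log_concave_between[OF g, of x y z] True e1 by (simp add: t_def)
  finally show ?thesis by (simp add: m_def)
next
  case False
  then have "x = y \<or> y = z" using xyz by auto
  then show ?thesis by auto
qed

text \<open>A concave function lies below its chords outside of the interval where they are taken.\<close>

lemma log_concave_extrapolate:
  assumes g: "log_concave g" and uwx: "u < w" "w \<le> x" and gu: "0 < g u"
  shows "g x \<le> g w * (g w / g u) powr ((x - w) / (w - u))"
proof (cases "x = w \<or> g x = 0")
  case True
  then show ?thesis using log_concave_nonneg[OF g] gu uwx
    by (cases "x = w") (auto simp: powr_def)
next
  case False
  then have wx: "w < x" and gx: "0 < g x"
    using uwx log_concave_nonneg[OF g, of x] by auto
  define s where "s = (w - u) / (x - u)"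
  have s: "0 < s" "s < 1" using uwx wx by (auto simp: s_def field_simps)
  have s1: "1 - s = (x - w) / (x - u)" using uwx wx by (simp add: s_def field_simps)
  have b: "g u powr (1 - s) * g x powr s \<le> g w"
    using log_concave_between[OF g uwx(1) wx] by (simp add: s1) (simp add: s_def)
  have p: "0 < g u powr (1 - s) * g x powr s" using gu gx by simp
  then have gw: "0 < g w" using b by linarith
  have "ln (g u powr (1 - s) * g x powr s) \<le> ln (g w)"
    using b p gw by simp
  then have l: "(1 - s) * ln (g u) + s * ln (g x) \<le> ln (g w)"
    using gu gx by (simp add: ln_mult ln_powr)
  \<comment> \<open>Solving the chord inequality \<open>l\<close> at \<open>w\<close> for
    \<open>ln (g x)\<close> produces the exponent \<open>(1 - s) / s\<close>, which is this
    \<open>r\<close>.\<close>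
  define r where "r = (x - w) / (w - u)"
  have r: "r = (1 - s) / s" using uwx wx by (simp add: r_def s1) (simp add: s_def)
  have "s * r = 1 - s" using s by (simp add: r)
  then have "s * (ln (g w) + r * (ln (g w) - ln (g u))) = s * ln (g w) + (1 - s) * (ln (g w) - ln (g u))"
    by (simp add: distrib_left flip: mult.assoc)
  then have "s * ln (g x) \<le> s * (ln (g w) + r * (ln (g w) - ln (g u)))"
    using l by (simp add: algebra_simps)
  then have "ln (g x) \<le> ln (g w) + r * (ln (g w) - ln (g u))"
    using s by simp
  also have "\<dots> = ln (g w * (g w / g u) powr r)"
    using gu gw by (simp add: ln_mult ln_powr ln_div)
  finally show ?thesis
    using gx gw gu by (simp add: r_def)
qed

text \<open>If \<open>x\<close> is no farther from \<open>w\<close> than \<open>w\<close> is from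
  \<open>u\<close>, the exponent in the extrapolated chord is at most 1, which gives a bound
  independent of \<open>x\<close>. The \<open>max\<close> covers rising and falling chords at
  once.\<close>

lemma log_concave_extrapolate_max:
  assumes g: "log_concave g" and uwx: "u < w" "w \<le> x" "x - w \<le> w - u" and gu: "0 < g u"
  shows "g x \<le> g w * max 1 (g w / g u)"
proof -
  define r where "r = (x - w) / (w - u)"
  have r: "0 \<le> r" "r \<le> 1" using uwx by (auto simp: r_def field_simps)
  have "(g w / g u) powr r \<le> max 1 (g w / g u) powr r"
    using log_concave_nonneg[OF g, of w] gu r by (intro powr_mono2) auto
  also have "\<dots> \<le> max 1 (g w / g u) powr 1"
    using r by (intro powr_mono) auto
  finally have "(g w / g u) powr r \<le> max 1 (g w / g u)" by simp
  then have "g w * (g w / g u) powr r \<le> g w * max 1 (g w / g u)"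
    using log_concave_nonneg[OF g, of w] by (intro mult_left_mono) auto
  then show ?thesis
    using log_concave_extrapolate[OF g uwx(1,2) gu] by (simp add: r_def)
qed

text \<open>The form in which upper bounds are transported: when \<open>l\<close> and
  \<open>M\<close> approach a common positive value, so does \<open>M * M / l\<close>, hence nothing
  is lost in the limit.\<close>

lemma log_concave_extrapolate_bound:
  assumes g: "log_concave g" and uwx: "u < w" "w \<le> x" "x - w \<le> w - u"
    and lu: "0 < l" "l \<le> g u" and gw: "g w \<le> M" and lM: "l \<le> M"
  shows "g x \<le> M * M / l"
proof -
  have gu: "0 < g u" using lu by simp
  have "g x \<le> g w * max 1 (g w / g u)"
    by (rule log_concave_extrapolate_max[OF g uwx gu])
  also have "\<dots> \<le> M * (M / l)"
  proof (rule mult_mono)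
    have "g w / g u \<le> M / l"
      using lu gw lM gu log_concave_nonneg[OF g, of w] by (intro frac_le) auto
    then show "max 1 (g w / g u) \<le> M / l" using lM lu by simp
  qed (use gw lM lu in auto)
  finally show ?thesis by simp
qed

text \<open>The chord from \<open>x0\<close> to \<open>x1\<close> falls at rate at least
  \<open>l\<close>, hence so does the one from \<open>x0\<close> to any \<open>x\<close> beyond
  \<open>x1\<close>, and extrapolating the latter reaches \<open>y\<close>. Two extrapolations are
  needed because the bound has to be relative to \<open>g x\<close>, not to
  \<open>g x1\<close>.\<close>

lemma log_concave_exp_decay:
  assumes g: "log_concave g" and x: "x0 < x1" "x1 \<le> x" "x \<le> y"
    and g0: "0 < g x0" and dec: "g x1 \<le> g x0 * exp (- l * (x1 - x0))" and l: "0 < l"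
  shows "g y \<le> g x * exp (- l * (y - x))"
proof -
  have decay: "(g w / g x0) powr r \<le> exp (- l * (w - x0) * r)"
    if "g w \<le> g x0 * exp (- l * (w - x0))" "0 \<le> r" "x0 < w" for w r
  proof -
    have "(g w / g x0) powr r \<le> exp (- l * (w - x0)) powr r"
      using that g0 log_concave_nonneg[OF g, of w] by (intro powr_mono2) (auto simp: field_simps)
    then show ?thesis by (simp add: powr_def mult_ac)
  qed
  have "g x \<le> g x1 * (g x1 / g x0) powr ((x - x1) / (x1 - x0))"
    by (rule log_concave_extrapolate[OF g x(1,2) g0])
  also have "\<dots> \<le> (g x0 * exp (- l * (x1 - x0))) * exp (- l * (x1 - x0) * ((x - x1) / (x1 - x0)))"
    using x g0 by (intro mult_mono decay dec) auto
  also have "\<dots> = g x0 * exp (- l * (x - x0))"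
    using x by (simp add: mult.assoc flip: exp_add) (simp add: algebra_simps)
  finally have gx: "g x \<le> g x0 * exp (- l * (x - x0))" .
  have "g y \<le> g x * (g x / g x0) powr ((y - x) / (x - x0))"
    using x by (intro log_concave_extrapolate[OF g _ _ g0]) auto
  also have "\<dots> \<le> g x * exp (- l * (x - x0) * ((y - x) / (x - x0)))"
    using x gx log_concave_nonneg[OF g, of x] by (intro mult_left_mono decay) auto
  also have "\<dots> = g x * exp (- l * (y - x))" using x by (simp add: field_simps)
  finally show ?thesis .
qed

section \<open>Integrals of exponential tails\<close>

lemma set_integral_exp_minus:
  fixes l x :: real
  assumes l: "0 < l"
  shows "set_integrable lborel {x<..} (\<lambda>y. exp (- l * (y - x)))"
    and "(LBINT y:{x<..}. exp (- l * (y - x))) = 1 / l"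
proof -
  have h: "((\<lambda>y. exp (l * x) * exp (- l * y)) has_integral exp (l * x) * (exp (- l * x) / l)) {x..}"
    by (intro has_integral_mult_right has_integral_exp_minus_to_infinity l)
  have eq: "exp (l * x) * exp (- l * y) = exp (- l * (y - x))" for y
    by (simp add: algebra_simps flip: exp_add)
  have h': "((\<lambda>y. exp (- l * (y - x))) has_integral 1 / l) {x..}"
    using h by (simp only: eq) (simp flip: exp_add)
  from h' have h2: "((\<lambda>y. exp (- l * (y - x))) has_integral 1 / l) {x<..}"
  proof (rule iffD1[OF has_integral_spike_set_eq, rotated 2])
    show "negligible {y \<in> {x..} - {x<..}. exp (- l * (y - x)) \<noteq> 0}"
      by (rule negligible_subset[of "{x}"]) auto
    show "negligible {y \<in> {x<..} - {x..}. exp (- l * (y - x)) \<noteq> 0}"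
      by (rule negligible_subset[of "{x}"]) auto
  qed
  have "(\<lambda>y. exp (- l * (y - x))) absolutely_integrable_on {x<..}"
    using h2 by (intro nonnegative_absolutely_integrable_1) (auto simp: integrable_on_def)
  then have si: "set_integrable lebesgue {x<..} (\<lambda>y. exp (- l * (y - x)))" .
  then show *: "set_integrable lborel {x<..} (\<lambda>y. exp (- l * (y - x)))"
    unfolding set_integrable_def
    by (subst (asm) integrable_completion) auto
  show "(LBINT y:{x<..}. exp (- l * (y - x))) = 1 / l"
    using set_borel_integral_eq_integral(2)[OF *] h2 by (simp add: integral_unique)
qed

text \<open>Both factors of the bound are exploited: \<open>eventually_tail_small\<close> makes the
  value \<open>g x\<close> small for a fixed rate, whereas in \<open>eventually_tail_slope\<close>
  the rate itself determines the limit.\<close>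

lemma log_concave_tail:
  assumes g: "log_concave g" and gi: "integrable lborel g" and x: "x0 < x1" "x1 \<le> x"
    and g0: "0 < g x0" and dec: "g x1 \<le> g x0 * exp (- l * (x1 - x0))" and l: "0 < l"
  shows "(LBINT y:{x<..}. g y) \<le> g x / l"
proof -
  have "(LBINT y:{x<..}. g y) \<le> (LBINT y:{x<..}. g x * exp (- l * (y - x)))"
  proof (rule set_integral_mono)
    show "set_integrable lborel {x<..} g"
      unfolding set_integrable_def by (rule integrable_mult_indicator) (use gi in auto)
    show "set_integrable lborel {x<..} (\<lambda>y. g x * exp (- l * (y - x)))"
      by (rule set_integrable_mult_right) (rule set_integral_exp_minus(1)[OF l])
    show "g y \<le> g x * exp (- l * (y - x))" if "y \<in> {x<..}" for y
      using log_concave_exp_decay[OF g x _ g0 dec l, of y] that by auto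
  qed
  also have "\<dots> = g x / l" using set_integral_exp_minus(2)[OF l] by simp
  finally show ?thesis .
qed

section \<open>Locally uniform convergence inside the support\<close>

lemma set_integrable_of_integrable:
  fixes g :: "real \<Rightarrow> real"
  assumes "integrable lborel g" "S \<in> sets borel"
  shows "set_integrable lborel S g"
  unfolding set_integrable_def by (rule integrable_mult_indicator) (use assms in auto)

lemma ereal_less_between:
  "c < ereal s \<Longrightarrow> s \<le> x \<Longrightarrow> c < ereal x"
  "ereal t < d \<Longrightarrow> x \<le> t \<Longrightarrow> ereal x < d"
  by (erule less_le_trans, simp) (erule le_less_trans[rotated], simp)

lemma set_integral_const_Icc:
  fixes u v x :: real
  assumes "u \<le> v"
  shows "(LBINT t:{u..v}. x) = x * (v - u)"
  using assms by (simp add: set_lebesgue_integral_def mult.commute)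

text \<open>Passes from locally uniform to uniform on compact sets: finitely many balls suffice, and
  finitely many eventual properties hold jointly.\<close>

lemma eventually_ball_compact:
  fixes K :: "'a::metric_space set"
  assumes K: "compact K"
    and loc: "\<And>x. x \<in> K \<Longrightarrow> \<exists>h>0. \<forall>\<^sub>F k in F. \<forall>y\<in>ball x h. P k y"
  shows "\<forall>\<^sub>F k in F. \<forall>y\<in>K. P k y"
proof -
  obtain h where h: "\<And>x. x \<in> K \<Longrightarrow> 0 < h x" "\<And>x. x \<in> K \<Longrightarrow> \<forall>\<^sub>F k in F. \<forall>y\<in>ball x (h x). P k y"
    using loc by metis
  obtain C where C: "C \<subseteq> K" "finite C" "K \<subseteq> (\<Union>x\<in>C. ball x (h x))"
  proof (rule compactE_image[OF K, of K "\<lambda>x. ball x (h x)"])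
    show "K \<subseteq> (\<Union>x\<in>K. ball x (h x))" using h(1) by force
  qed auto
  have "\<forall>\<^sub>F k in F. \<forall>x\<in>C. \<forall>y\<in>ball x (h x). P k y"
    using C h(2) by (intro eventually_ball_finite) auto
  then show ?thesis
    by eventually_elim (use C(3) in blast)
qed

text \<open>The assumptions are invariant under the reflection \<open>x \<mapsto> - x\<close>, so it suffices to study the right end.\<close>

locale log_concave_seq =
  fixes g :: "nat \<Rightarrow> real \<Rightarrow> real" and f :: "real \<Rightarrow> real" and a b c d :: ereal
  assumes lcg: "\<And>k. log_concave (g k)" and lcf: "log_concave f"
    and gint: "\<And>k. integrable lborel (g k)" and fint: "integrable lborel f"
    and uscf: "\<And>x e. 0 < e \<Longrightarrow> \<forall>\<^sub>F y in at x. f y < f x + e"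
    and ac: "a \<le> c" and cd: "c < d" and db: "d \<le> b"
    and fpos: "\<And>x. c < ereal x \<Longrightarrow> ereal x < d \<Longrightarrow> 0 < f x"
    and fzero_right: "\<And>x. d < ereal x \<Longrightarrow> ereal x < b \<Longrightarrow> f x = 0"
    and fzero_left: "\<And>x. a < ereal x \<Longrightarrow> ereal x < c \<Longrightarrow> f x = 0"
    and conv: "\<And>x y. a < ereal x \<Longrightarrow> x < y \<Longrightarrow> ereal y < b \<Longrightarrow>
        (\<lambda>k. LBINT t:{x..y}. g k t) \<longlonglongrightarrow> (LBINT t:{x..y}. f t)"
begin

lemma g_nonneg [simp]: "0 \<le> g k x" and f_nonneg [simp]: "0 \<le> f x"
  using lcg lcf log_concave_nonneg by auto

lemma g_set_integrable: "S \<in> sets borel \<Longrightarrow> set_integrable lborel S (g k)"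
  and f_set_integrable: "S \<in> sets borel \<Longrightarrow> set_integrable lborel S f"
  using set_integrable_of_integrable gint fint by auto

lemma reflect:
  "log_concave_seq (\<lambda>k x. g k (- x)) (\<lambda>x. f (- x)) (- b) (- a) (- d) (- c)"
proof
  have *: "log_concave (\<lambda>x. h (- x))" if "log_concave h" for h
    unfolding log_concave_def
  proof (intro conjI allI ballI)
    fix x y t :: real assume t: "t \<in> {0<..<1}"
    have "h (- x) powr (1 - t) * h (- y) powr t \<le> h ((1 - t) * (- x) + t * (- y))"
      using that t unfolding log_concave_def by blast
    then show "h (- x) powr (1 - t) * h (- y) powr t \<le> h (- ((1 - t) * x + t * y))"
      by (simp add: algebra_simps)
  qed (use that log_concave_nonneg in auto)
  show "log_concave (\<lambda>x. g k (- x))" for k by (rule *[OF lcg])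
  show "log_concave (\<lambda>x. f (- x))" by (rule *[OF lcf])
  have **: "integrable lborel (\<lambda>x. h (- x))" if "integrable lborel h" for h :: "real \<Rightarrow> real"
    using lborel_integrable_real_affine[OF that, of "-1" 0] by simp
  show "integrable lborel (\<lambda>x. g k (- x))" for k by (rule **[OF gint])
  show "integrable lborel (\<lambda>x. f (- x))" by (rule **[OF fint])
  show "\<forall>\<^sub>F y in at x. f (- y) < f (- x) + e" if e: "0 < e" for x e
  proof -
    obtain r where r: "0 < r" "\<And>y. y \<noteq> - x \<Longrightarrow> dist y (- x) < r \<Longrightarrow> f y < f (- x) + e"
      using uscf[OF e, of "- x"] by (auto simp: eventually_at)
    have "f (- y) < f (- x) + e" if "y \<noteq> x" "dist y x < r" for y
      using that by (intro r(2)) (auto simp: dist_real_def)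
    then show ?thesis using r(1) unfolding eventually_at by blast
  qed
  show "- b \<le> - d" "- d < - c" "- c \<le> - a" using ac cd db by auto
  show "0 < f (- x)" if "- d < ereal x" "ereal x < - c" for x
    using that by (intro fpos) (simp_all add: ereal_less_uminus_reorder ereal_uminus_less_reorder flip: uminus_ereal.simps(1))
  show "f (- x) = 0" if "- c < ereal x" "ereal x < - a" for x
    using that by (intro fzero_left) (simp_all add: ereal_less_uminus_reorder ereal_uminus_less_reorder flip: uminus_ereal.simps(1))
  show "f (- x) = 0" if "- b < ereal x" "ereal x < - d" for x
    using that by (intro fzero_right) (simp_all add: ereal_less_uminus_reorder ereal_uminus_less_reorder flip: uminus_ereal.simps(1))
  have i: "(LBINT t:{x..y}. h (- t)) = (LBINT t:{- y..- x}. h t)" for h :: "real \<Rightarrow> real" and x y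
    by (subst set_integral_reflect) (auto intro!: arg_cong2[where f="set_lebesgue_integral lborel"])
  show "(\<lambda>k. LBINT t:{x..y}. g k (- t)) \<longlonglongrightarrow> (LBINT t:{x..y}. f (- t))"
    if "- b < ereal x" "x < y" "ereal y < - a" for x y
    unfolding i using that
    by (intro conv) (simp_all add: ereal_less_uminus_reorder ereal_uminus_less_reorder flip: uminus_ereal.simps(1))
qed

text \<open>Makes every estimate on \<open>g k\<close> available for \<open>f\<close> itself, as
  needed for the tails of \<open>f\<close> in \<open>eventually_L1\<close>.\<close>

lemma const: "log_concave_seq (\<lambda>k. f) f a b c d"
  by unfold_locales (use lcf fint uscf ac cd db fpos fzero_left fzero_right in auto)

text \<open>Only integrals are known to converge, so values are reached by averaging: were
  \<open>g k\<close> at most \<open>m'\<close> on all of \<open>{u..v}\<close>, its integral would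
  stay below the limit. The point \<open>w\<close> varies with \<open>k\<close>; only the interval
  containing it is fixed.\<close>

lemma eventually_value_ge:
  assumes uv: "a < ereal u" "u < v" "ereal v < b" and f: "\<And>t. t \<in> {u..v} \<Longrightarrow> m \<le> f t" and m': "m' < m"
  shows "\<forall>\<^sub>F k in sequentially. \<exists>w\<in>{u..v}. m' < g k w"
proof -
  have c: "(LBINT t:{u..v}. (x::real)) = x * (v - u)" for x using uv by (intro set_integral_const_Icc) auto
  have "m' * (v - u) < m * (v - u)" using uv m' by simp
  also have "\<dots> = (LBINT t:{u..v}. m)" using c by simp
  also have "\<dots> \<le> (LBINT t:{u..v}. f t)"
    using f by (intro set_integral_mono f_set_integrable borel_integrable_atLeastAtMost') auto
  finally have "\<forall>\<^sub>F k in sequentially. m' * (v - u) < (LBINT t:{u..v}. g k t)"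
    using conv[OF uv] order_tendstoD(1) by blast
  then show ?thesis
  proof eventually_elim
    case (elim k)
    show ?case
    proof (rule ccontr)
      assume "\<not> (\<exists>w\<in>{u..v}. m' < g k w)"
      then have "(LBINT t:{u..v}. g k t) \<le> (LBINT t:{u..v}. m')"
        by (intro set_integral_mono g_set_integrable borel_integrable_atLeastAtMost') (auto simp: not_less)
      then show False using elim c[of m'] by simp
    qed
  qed
qed

lemma eventually_value_le:
  assumes uv: "a < ereal u" "u < v" "ereal v < b" and f: "\<And>t. t \<in> {u..v} \<Longrightarrow> f t \<le> m" and m': "m < m'"
  shows "\<forall>\<^sub>F k in sequentially. \<exists>w\<in>{u..v}. g k w < m'"
proof -
  have c: "(LBINT t:{u..v}. (x::real)) = x * (v - u)" for x using uv by (intro set_integral_const_Icc) auto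
  have "(LBINT t:{u..v}. f t) \<le> (LBINT t:{u..v}. m)"
    using f by (intro set_integral_mono f_set_integrable borel_integrable_atLeastAtMost') auto
  also have "\<dots> < m' * (v - u)" using c[of m] uv m' by simp
  finally have "\<forall>\<^sub>F k in sequentially. (LBINT t:{u..v}. g k t) < m' * (v - u)"
    using conv[OF uv] order_tendstoD(2) by blast
  then show ?thesis
  proof eventually_elim
    case (elim k)
    show ?case
    proof (rule ccontr)
      assume "\<not> (\<exists>w\<in>{u..v}. g k w < m')"
      then have "(LBINT t:{u..v}. m') \<le> (LBINT t:{u..v}. g k t)"
        by (intro set_integral_mono g_set_integrable borel_integrable_atLeastAtMost') (auto simp: not_less)
      then show False using elim c[of m'] by simp
    qed
  qed
qed

text \<open>Finite convex functions on open intervals are continuous; this is applied to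
  \<open>- ln f\<close>, which is finite where \<open>f\<close> is positive.\<close>

lemma f_isCont:
  assumes x: "c < ereal x" "ereal x < d"
  shows "isCont f x"
proof -
  let ?I = "einterval c d"
  have pos: "0 < f y" if "y \<in> ?I" for y using that fpos by (auto simp: einterval_def)
  have cvx: "convex ?I"
    unfolding is_interval_convex_1[symmetric] is_interval_1 einterval_def using ereal_less_between by blast
  have "convex_on ?I (\<lambda>y. - ln (f y))"
  proof (rule convex_onI[OF _ cvx])
    fix t y z :: real assume t: "0 < t" "t < 1" and yz: "y \<in> ?I" "z \<in> ?I"
    let ?m = "(1 - t) * y + t * z"
    have "?m \<in> ?I" using convexD[OF cvx yz, of "1 - t" t] t by simp
    then have m: "0 < f ?m" by (rule pos)
    have le: "f y powr (1 - t) * f z powr t \<le> f ?m"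
      using lcf t unfolding log_concave_def by auto
    have "0 < f y powr (1 - t) * f z powr t" using pos yz by (simp add: less_le)
    then have "ln (f y powr (1 - t) * f z powr t) \<le> ln (f ?m)" using le m by simp
    then show "- ln (f ((1 - t) *\<^sub>R y + t *\<^sub>R z)) \<le> (1 - t) * - ln (f y) + t * - ln (f z)"
      using pos[OF yz(1)] pos[OF yz(2)] by (simp add: ln_mult ln_powr)
  qed
  then have "continuous_on ?I (\<lambda>y. - ln (f y))"
    by (intro convex_on_continuous) (auto simp: open_einterval)
  then have "continuous_on ?I (\<lambda>y. ln (f y))"
    using continuous_on_minus by fastforce
  then have "continuous_on ?I (\<lambda>y. exp (ln (f y)))"
    by (rule continuous_on_exp)
  then have "continuous_on ?I f"
    by (rule continuous_on_eq) (use pos in auto)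
  then show ?thesis
    using x continuous_on_eq_continuous_at[OF open_einterval, of c d f] by (auto simp: einterval_def)
qed

lemma f_near:
  assumes x: "c < ereal x" "ereal x < d" and e: "0 < e"
  shows "\<exists>h>0. c < ereal (x - h) \<and> ereal (x + h) < d \<and> (\<forall>t\<in>{x-h..x+h}. \<bar>f t - f x\<bar> < e)"
proof -
  have "\<forall>\<^sub>F y in nhds x. \<bar>f y - f x\<bar> < e"
    using f_isCont[OF x] e
    by (auto simp: isCont_def tendsto_iff dist_real_def eventually_at_filter elim!: eventually_mono)
  moreover have "\<forall>\<^sub>F y in nhds x. y \<in> einterval c d"
    using x by (intro eventually_nhds_in_open open_einterval) (auto simp: einterval_def)
  ultimately have "\<forall>\<^sub>F y in nhds x. \<bar>f y - f x\<bar> < e \<and> y \<in> einterval c d"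
    by eventually_elim auto
  then obtain r where r: "0 < r" "\<And>y. dist y x < r \<Longrightarrow> \<bar>f y - f x\<bar> < e \<and> y \<in> einterval c d"
    by (auto simp: eventually_nhds_metric)
  show ?thesis
  proof (intro exI[of _ "r / 2"] conjI ballI)
    show "c < ereal (x - r / 2)" "ereal (x + r / 2) < d"
      using r(2)[of "x - r / 2"] r(2)[of "x + r / 2"] r(1) by (auto simp: dist_real_def einterval_def)
    show "\<bar>f t - f x\<bar> < e" if "t \<in> {x - r / 2..x + r / 2}" for t
      using r(2)[of t] that r(1) by (auto simp: dist_real_def)
  qed (use r in auto)
qed

text \<open>On either side of a short interval around \<open>x\<close> there are points where \<open>g k\<close> is close to its
  average and hence to \<open>f x\<close>; log-concavity extends the bounds to the whole interval.\<close>

lemma locally_uniform: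
  assumes x: "c < ereal x" "ereal x < d" and e: "0 < e"
  shows "\<exists>h>0. \<forall>\<^sub>F k in sequentially. \<forall>y\<in>ball x h. \<bar>g k y - f y\<bar> < e"
proof -
  have fx: "0 < f x" using x fpos by auto
  \<comment> \<open>This is the bound of \<open>log_concave_extrapolate_bound\<close> for
    \<open>M = f x + 2 * s\<close> and \<open>l = f x - 2 * s\<close>, plus the oscillation
    \<open>s\<close> of \<open>f\<close> near \<open>x\<close>. It tends to \<open>f x\<close>, so a
    suitable \<open>s\<close> exists.\<close>
  have "((\<lambda>s. (f x + 2 * s) * (f x + 2 * s) / (f x - 2 * s) + s) \<longlongrightarrow> (f x + 2 * 0) * (f x + 2 * 0) / (f x - 2 * 0) + 0) (at_right 0)"
    using fx by (intro tendsto_intros) auto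
  then have "((\<lambda>s. (f x + 2 * s) * (f x + 2 * s) / (f x - 2 * s) + s) \<longlongrightarrow> f x) (at_right 0)"
    using fx by simp
  then have "\<forall>\<^sub>F s in at_right 0. (f x + 2 * s) * (f x + 2 * s) / (f x - 2 * s) + s < f x + e"
    using e by (intro order_tendstoD(2)[where a="f x + e"]) auto
  moreover have "\<forall>\<^sub>F s in at_right 0. s < min (e / 3) (f x / 2)"
    by (rule eventually_at_rightI[of 0 "min (e / 3) (f x / 2)"]) (use fx e in auto)
  moreover have "\<forall>\<^sub>F s in at_right 0. (0::real) < s" by (simp add: eventually_at_right_less)
  ultimately have "\<forall>\<^sub>F s in at_right 0. 0 < s \<and> s < e / 3 \<and> s < f x / 2 \<and> 
      (f x + 2 * s) * (f x + 2 * s) / (f x - 2 * s) + s < f x + e"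
    by eventually_elim auto
  then obtain s where s: "0 < s" "s < e / 3" "s < f x / 2"
      "(f x + 2 * s) * (f x + 2 * s) / (f x - 2 * s) + s < f x + e"
    using eventually_happens'[OF trivial_limit_at_right_real] by blast
  obtain H where H: "0 < H" "c < ereal (x - H)" "ereal (x + H) < d" "\<And>t. t \<in> {x-H..x+H} \<Longrightarrow> \<bar>f t - f x\<bar> < s"
    using f_near[OF x s(1)] by blast
  \<comment> \<open>Eight units fit to the left of \<open>x\<close>: \<open>u\<close> lies in
    \<open>{x-8*h..x-7*h}\<close> and \<open>w\<close> in \<open>{x-3*h..x-2*h}\<close>. Then
    \<open>w\<close> is at least \<open>4 * h\<close> from \<open>u\<close> and at most
    \<open>4 * h\<close> from each point of the ball, as the extrapolation demands.\<close>
  define h where "h = H / 8"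
  have h: "0 < h" using H by (simp add: h_def)
  have in_ab: "a < ereal y" "ereal y < b" if "y \<in> {x-H..x+H}" for y
  proof -
    show "a < ereal y"
      by (rule le_less_trans[OF ac ereal_less_between(1)[OF H(2)]]) (use that in simp)
    show "ereal y < b"
      by (rule less_le_trans[OF ereal_less_between(2)[OF H(3)] db]) (use that in simp)
  qed
  have f1: "f x - s \<le> f t" "f t \<le> f x + s" if "t \<in> {x-8*h..x+8*h}" for t
    using H(4)[of t] that by (auto simp: h_def)
  have "\<forall>\<^sub>F k in sequentially. \<exists>w\<in>{x-8*h..x-7*h}. f x - 2 * s < g k w"
    using h s by (intro eventually_value_ge[where m="f x - s"] in_ab f1) (auto simp: h_def)
  moreover have "\<forall>\<^sub>F k in sequentially. \<exists>w\<in>{x+h..x+2*h}. f x - 2 * s < g k w"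
    using h s by (intro eventually_value_ge[where m="f x - s"] in_ab f1) (auto simp: h_def)
  moreover have "\<forall>\<^sub>F k in sequentially. \<exists>w\<in>{x-3*h..x-2*h}. g k w < f x + 2 * s"
    using h s by (intro eventually_value_le[where m="f x + s"] in_ab f1) (auto simp: h_def)
  ultimately have "\<forall>\<^sub>F k in sequentially. \<forall>y\<in>ball x h. \<bar>g k y - f y\<bar> < e"
  proof eventually_elim
    case (elim k)
    then obtain u v w where uvw: "u \<in> {x-8*h..x-7*h}" "f x - 2 * s < g k u"
        "v \<in> {x+h..x+2*h}" "f x - 2 * s < g k v" "w \<in> {x-3*h..x-2*h}" "g k w < f x + 2 * s" by blast
    show ?case
    proof
      fix y assume "y \<in> ball x h"
      then have y: "x - h < y" "y < x + h" by (auto simp: dist_real_def)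
      have fy: "f x - s \<le> f y" "f y \<le> f x + s" using f1[of y] y h by auto
      have "min (g k u) (g k v) \<le> g k y"
        using uvw y h by (intro log_concave_min[OF lcg]) auto
      then have "f x - 2 * s < g k y" using uvw by linarith
      moreover have "g k y \<le> (f x + 2 * s) * (f x + 2 * s) / (f x - 2 * s)"
        using uvw y h s by (intro log_concave_extrapolate_bound[OF lcg, of u w]) auto
      ultimately show "\<bar>g k y - f y\<bar> < e"
        using fy s unfolding abs_less_iff by linarith
    qed
  qed
  then show ?thesis using h by blast
qed

lemma uniform_compact:
  assumes st: "c < ereal s" "ereal t < d" and e: "0 < e"
  shows "\<forall>\<^sub>F k in sequentially. \<forall>y\<in>{s..t}. \<bar>g k y - f y\<bar> < e"
proof (rule eventually_ball_compact[OF compact_Icc])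
  fix x assume "x \<in> {s..t}"
  then have "c < ereal x" "ereal x < d"
    using ereal_less_between(1)[OF st(1)] ereal_less_between(2)[OF st(2)] by auto
  then show "\<exists>h>0. \<forall>\<^sub>F k in sequentially. \<forall>y\<in>ball x h. \<bar>g k y - f y\<bar> < e"
    using e by (rule locally_uniform)
qed

lemma pointwise: "c < ereal x \<Longrightarrow> ereal x < d \<Longrightarrow> (\<lambda>k. g k x) \<longlonglongrightarrow> f x"
  unfolding tendsto_iff dist_real_def
  using uniform_compact[of x x] by auto

end

section \<open>The right end of the support\<close>

lemma set_integral_mono_subset:
  fixes h :: "real \<Rightarrow> real"
  assumes "integrable lborel h" "\<And>x. 0 \<le> h x" "A \<subseteq> B" "A \<in> sets borel" "B \<in> sets borel"
  shows "(LBINT x:A. h x) \<le> (LBINT x:B. h x)"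
  unfolding set_lebesgue_integral_def
  using assms by (intro integral_mono integrable_mult_indicator) (auto split: split_indicator)

context log_concave_seq begin

text \<open>For log-concave \<open>f\<close> this says that \<open>f x\<close> tends to 0 as \<open>x\<close> increases to \<open>d\<close>, which may be \<open>\<infinity>\<close>.\<close>

definition vanishing_right :: bool where
  "vanishing_right \<longleftrightarrow> (\<forall>e>0. \<forall>s. ereal s < d \<longrightarrow> (\<exists>t>s. c < ereal t \<and> ereal t < d \<and> f t < e))"

lemma inner_point:
  assumes "ereal s < d"
  obtains t where "s < t" "c < ereal t" "ereal t < d"
proof -
  have "max (ereal s) c < d" using assms cd by simp
  then obtain t where "max (ereal s) c < ereal t" "ereal t < d"
    using ereal_dense2 by blast
  then show ?thesis using that by auto
qed

lemma vanishing_right_if_zero: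
  assumes d: "d = ereal e" and fe: "f e = 0"
  shows vanishing_right
  unfolding vanishing_right_def
proof (intro allI impI)
  fix \<eta> s :: real assume \<eta>: "0 < \<eta>" and s: "ereal s < d"
  obtain r where r: "0 < r" "\<And>y. y \<noteq> e \<Longrightarrow> dist y e < r \<Longrightarrow> f y < f e + \<eta>"
    using uscf[OF \<eta>, of e] by (auto simp: eventually_at)
  have "ereal (max s (e - r)) < d" using s r d by simp
  then obtain t where t: "max s (e - r) < t" "c < ereal t" "ereal t < d"
    using inner_point by blast
  then have "f t < \<eta>" using r(2)[of t] fe d by (auto simp: dist_real_def)
  then show "\<exists>t>s. c < ereal t \<and> ereal t < d \<and> f t < \<eta>" using t by auto
qed

text \<open>At a finite end, upper semicontinuity turns a zero value into a zero limit. At an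
  infinite end, integrability does not allow \<open>f\<close> to stay above a positive
  level.\<close>

lemma vanishing_right_or_jump:
  obtains (vanishing) vanishing_right | (jump) e where "d = ereal e" "0 < f e"
proof (cases d)
  case (real e)
  then show ?thesis
    using vanishing_right_if_zero[of e] that f_nonneg[of e] by (cases "f e = 0") (auto simp: less_le)
next
  case MInf
  then show ?thesis using cd by simp
next
  case PInf
  have vanishing_right
    unfolding vanishing_right_def
  proof (intro allI impI, rule ccontr)
    fix \<eta> s :: real assume \<eta>: "0 < \<eta>" and s: "ereal s < d"
    assume no: "\<not> (\<exists>t>s. c < ereal t \<and> ereal t < d \<and> f t < \<eta>)"
    obtain u where u: "s < u" "c < ereal u" "ereal u < d" using inner_point[OF s] .
    define I where "I = (LBINT t. f t)"
    have "0 \<le> I" unfolding I_def by simp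
    \<comment> \<open>On an interval of this length a function that is at least \<eta> has integral
      at least \<open>I + \<eta>\<close>, more than the whole mass of \<open>f\<close>.\<close>
    define v where "v = u + (I / \<eta> + 1)"
    have v: "u \<le> v" using \<open>0 \<le> I\<close> \<eta> by (simp add: v_def)
    have "\<eta> \<le> f t" if "t \<in> {u..v}" for t
      using no that u(1) ereal_less_between(1)[OF u(2), of t] PInf by (force simp: not_less)
    then have "(LBINT t:{u..v}. \<eta>) \<le> (LBINT t:{u..v}. f t)"
      by (intro set_integral_mono f_set_integrable borel_integrable_atLeastAtMost') auto
    also have "\<dots> \<le> (LBINT t:UNIV. f t)"
      by (rule set_integral_mono_subset[OF fint]) auto
    also have "\<dots> = I" by (simp add: I_def set_lebesgue_integral_def)
    finally have "\<eta> * (v - u) \<le> I" using set_integral_const_Icc[OF v] by simp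
    moreover have "\<eta> * (v - u) = I + \<eta>" using \<eta> by (simp add: v_def distrib_left)
    ultimately show False using \<eta> by simp
  qed
  then show ?thesis by (rule that(1))
qed

text \<open>Upper semicontinuity bounds \<open>f\<close> from above near \<open>e\<close>. From
  below, \<open>f\<close> dominates the log-linear interpolation between an inner point
  \<open>u\<close> and \<open>e\<close>, which tends to \<open>f e\<close>.\<close>

lemma f_left_limit:
  assumes d: "d = ereal e" and fe: "0 < f e"
  shows "(f \<longlongrightarrow> f e) (at_left e)"
proof (rule order_tendstoI)
  fix m assume "f e < m"
  then have "\<forall>\<^sub>F y in at e. f y < m" using uscf[of "m - f e" e] by simp
  then show "\<forall>\<^sub>F y in at_left e. f y < m"
    by (rule filter_leD[OF at_le, rotated]) simp
next
  fix m assume m: "m < f e"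
  obtain u where u: "c < ereal u" "ereal u < d" using ereal_dense2[OF cd] by blast
  have ue: "u < e" and fu: "0 < f u" using u d fpos by auto
  have "((\<lambda>t. f u powr ((e - t) / (e - u)) * f e powr ((t - u) / (e - u))) \<longlongrightarrow>
      f u powr ((e - e) / (e - u)) * f e powr ((e - u) / (e - u))) (at_left e)"
    using fu fe ue by (intro tendsto_intros) auto
  then have "\<forall>\<^sub>F t in at_left e. m < f u powr ((e - t) / (e - u)) * f e powr ((t - u) / (e - u))"
    using m fu fe ue by (intro order_tendstoD(1)) auto
  moreover have "\<forall>\<^sub>F t in at_left e. u < t \<and> t < e"
    using eventually_at_left[OF ue] ue by blast
  ultimately show "\<forall>\<^sub>F t in at_left e. m < f t"
    by eventually_elim (use log_concave_between[OF lcf] in \<open>blast intro: less_le_trans\<close>)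
qed

lemma eventually_at_left_inner:
  assumes d: "d = ereal e" and P: "\<forall>\<^sub>F t in at_left e. P t" and s: "s < e"
  obtains t where "s < t" "c < ereal t" "t < e" "\<And>x. t \<le> x \<Longrightarrow> x < e \<Longrightarrow> P x"
proof -
  obtain r where r: "r < e" "\<And>x. r < x \<Longrightarrow> x < e \<Longrightarrow> P x"
    using P eventually_at_left[OF s] by blast
  have "ereal (max s r) < d" using r s d by simp
  then obtain t where t: "max s r < t" "c < ereal t" "ereal t < d"
    using inner_point by blast
  show ?thesis using t r(2) d by (intro that[of t]) auto
qed

text \<open>As \<open>d < b\<close>, integrals still converge on some \<open>{u..v}\<close> between
  \<open>d\<close> and \<open>e1\<close>, where \<open>f\<close> vanishes. So \<open>g k\<close> is
  tiny at some \<open>w\<close> there while it stays bounded below at \<open>x0\<close>, and from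
  \<open>w\<close> on it cannot rise again.\<close>

lemma eventually_small_beyond:
  assumes db: "d < b" and e1: "d < ereal e1" and \<eta>: "0 < \<eta>"
  shows "\<forall>\<^sub>F k in sequentially. \<forall>x\<ge>e1. g k x < \<eta>"
proof -
  obtain x0 where x0: "c < ereal x0" "ereal x0 < d" using ereal_dense2[OF cd] by blast
  have fx0: "0 < f x0" using x0 fpos by auto
  have "d < min b (ereal e1)" using db e1 by simp
  then obtain u where u: "d < ereal u" "ereal u < min b (ereal e1)" using ereal_dense2 by blast
  obtain v where v: "ereal u < ereal v" "ereal v < min b (ereal e1)" using ereal_dense2[OF u(2)] by blast
  have f0: "f t \<le> 0" if "t \<in> {u..v}" for t
  proof -
    have "f t = 0"
      by (rule fzero_right)
        (use that v ereal_less_between(1)[OF u(1), of t] ereal_less_between(2)[of v b t] in auto)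
    then show ?thesis by simp
  qed
  have "a < ereal u" using ac cd u by (meson le_less_trans less_trans)
  \<comment> \<open>Staying below \<open>f x0 / 2 < g k x0\<close> ensures that in
    \<open>min (g k x0) (g k x) \<le> g k w\<close> the minimum is \<open>g k x\<close>.\<close>
  then have "\<forall>\<^sub>F k in sequentially. \<exists>w\<in>{u..v}. g k w < min \<eta> (f x0 / 2)"
    using v \<eta> fx0 f0 by (intro eventually_value_le[of _ _ 0]) auto
  moreover have "\<forall>\<^sub>F k in sequentially. f x0 / 2 < g k x0"
    using order_tendstoD(1)[OF pointwise[OF x0], of "f x0 / 2"] fx0 by simp
  ultimately show ?thesis
  proof eventually_elim
    case (elim k)
    then obtain w where w: "u \<le> w" "w \<le> v" "g k w < min \<eta> (f x0 / 2)" by auto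
    show ?case
    proof (intro allI impI)
      fix x assume x: "e1 \<le> x"
      have "x0 < u" using less_trans[OF x0(2) u(1)] by simp
      moreover have "v < e1" using v by simp
      ultimately have "min (g k x0) (g k x) \<le> g k w"
        using w x by (intro log_concave_min[OF lcg]) auto
      then show "g k x < \<eta>" using w elim by auto
    qed
  qed
qed

section \<open>Mass of the tails at the end of the support\<close>

lemma tail_mono: "t0 \<le> t \<Longrightarrow> (LBINT y:{t<..}. g k y) \<le> (LBINT y:{t0<..}. g k y)"
  by (intro set_integral_mono_subset gint) auto

text \<open>The hypothesis excludes just the case of a jump at \<open>d = b\<close>, where the tails
  need not become small. If \<open>d < b\<close>, the tail is cut at a point \<open>e'\<close>
  slightly beyond the jump: up to \<open>e'\<close> the integrals converge, beyond it the decay is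
  exponential.\<close>

lemma eventually_tail_small:
  assumes vd: "vanishing_right \<or> d < b" and \<eta>: "0 < \<eta>"
  shows "\<exists>t. c < ereal t \<and> ereal t < d \<and> (\<forall>\<^sub>F k in sequentially. (LBINT y:{t<..}. g k y) \<le> \<eta>)"
proof -
  obtain x0 where x0: "c < ereal x0" "ereal x0 < d" using ereal_dense2[OF cd] by blast
  have fx0: "0 < f x0" using x0 fpos by auto
  show ?thesis
  proof (cases vanishing_right)
    case True
    \<comment> \<open>A decrease by the factor \<open>exp 1\<close> from \<open>x0\<close> to
      \<open>x1\<close> is a rate of \<open>1 / (x1 - x0)\<close>. This rate stays fixed while
      \<open>t\<close> moves right until \<open>f t\<close> is small enough.\<close>
    have "0 < f x0 * exp (- 1)" using fx0 by simp
    then obtain x1 where x1: "x0 < x1" "c < ereal x1" "ereal x1 < d" "f x1 < f x0 * exp (- 1)"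
      using True x0 unfolding vanishing_right_def by blast
    define l where "l = 1 / (x1 - x0)"
    have l: "0 < l" "l * (x1 - x0) = 1" using x1 by (auto simp: l_def)
    have "0 < \<eta> * l" using \<eta> l by simp
    then obtain t where t: "x1 < t" "c < ereal t" "ereal t < d" "f t < \<eta> * l"
      using True x1 unfolding vanishing_right_def by blast
    have "\<forall>\<^sub>F k in sequentially. g k t < \<eta> * l"
      using order_tendstoD(2)[OF pointwise[OF t(2,3)] t(4)] .
    moreover have "\<forall>\<^sub>F k in sequentially. 0 < g k x0"
      using order_tendstoD(1)[OF pointwise[OF x0] fx0] .
    moreover have "(\<lambda>k. g k x0 * exp (- 1) - g k x1) \<longlonglongrightarrow> f x0 * exp (- 1) - f x1"
      by (intro tendsto_intros pointwise x0 x1)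
    then have "\<forall>\<^sub>F k in sequentially. 0 < g k x0 * exp (- 1) - g k x1"
      using x1(4) by (intro order_tendstoD(1)) auto
    ultimately have "\<forall>\<^sub>F k in sequentially. (LBINT y:{t<..}. g k y) \<le> \<eta>"
    proof eventually_elim
      case (elim k)
      have "(LBINT y:{t<..}. g k y) \<le> g k t / l"
        using elim x1 t l by (intro log_concave_tail[OF lcg gint, of x0 x1]) auto
      also have "\<dots> \<le> \<eta>" using elim l by (simp add: field_simps)
      finally show ?case .
    qed
    then show ?thesis using t by blast
  next
    case False
    then have db: "d < b" using vd by simp
    obtain e where d: "d = ereal e" using False vanishing_right_or_jump by metis
    have x0e: "x0 < e" using x0 d by simp
    \<comment> \<open>For the midpoint, all of \<open>{w..e}\<close> is in the range of
      \<open>log_concave_extrapolate_max\<close>, whence \<open>f\<close> is at most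
      \<open>C\<close> there.\<close>
    define w where "w = (x0 + e) / 2"
    define C where "C = f w * max 1 (f w / f x0)"
    have C0: "0 \<le> C" by (simp add: C_def)
    have w: "x0 < w" "w < e" using x0e by (auto simp: w_def)
    \<comment> \<open>The strip \<open>{t..e'}\<close> will be shorter than \<open>2 * s\<close> and
      so carry at most half of \<eta> under \<open>f\<close>. One quarter remains for the
      convergence of the integrals and one for the tail beyond \<open>e'\<close>.\<close>
    define s where "s = \<eta> / (4 * (C + 1))"
    have s: "0 < s" "C * s \<le> \<eta> / 4" using C0 \<eta> by (auto simp: s_def field_simps)
    define t where "t = max w (e - s)"
    have t: "w \<le> t" "t < e" "e - s \<le> t" using w s by (auto simp: t_def)
    have ct: "c < ereal t" using ereal_less_between(1)[OF x0(1)] t w by simp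
    have "ereal e < min b (ereal (e + s))" using db d s by simp
    then obtain e' where e': "ereal e < ereal e'" "ereal e' < min b (ereal (e + s))"
      using ereal_dense2 by blast
    have fC: "f y \<le> C" if "y \<in> {t..e'}" for y
    proof (cases "y \<le> e")
      case True
      have "w - x0 = e - w" by (simp add: w_def field_simps)
      then show ?thesis
        unfolding C_def using True that t w fx0 by (intro log_concave_extrapolate_max[OF lcf]) auto
    next
      case False
      then have "f y = 0"
        using that d e' ereal_less_between(2)[of e' b y] by (intro fzero_right) auto
      then show ?thesis using C0 by simp
    qed
    have te': "t < e'" using t e' by simp
    have xe': "x0 < e'" using x0e e' by simp
    define l where "l = 1 / (e' - x0)"
    have l: "0 < l" "l * (e' - x0) = 1" using xe' by (auto simp: l_def)
    have "(LBINT y:{t..e'}. f y) \<le> (LBINT y:{t..e'}. C)"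
      using fC by (intro set_integral_mono f_set_integrable borel_integrable_atLeastAtMost') auto
    also have "\<dots> = C * (e' - t)" using te' by (intro set_integral_const_Icc) auto
    also have "\<dots> \<le> C * (2 * s)" using C0 e' t by (intro mult_left_mono) auto
    also have "\<dots> < \<eta> / 2 + \<eta> / 4" using s \<eta> by simp
    finally have "(LBINT y:{t..e'}. f y) < \<eta> / 2 + \<eta> / 4" .
    moreover have "(\<lambda>k. LBINT y:{t..e'}. g k y) \<longlonglongrightarrow> (LBINT y:{t..e'}. f y)"
      using te' ct e' ac by (intro conv) auto
    ultimately have "\<forall>\<^sub>F k in sequentially. (LBINT y:{t..e'}. g k y) < \<eta> / 2 + \<eta> / 4"
      by (rule order_tendstoD(2)[rotated])
    moreover have "\<forall>\<^sub>F k in sequentially. f x0 / 2 < g k x0"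
      using order_tendstoD(1)[OF pointwise[OF x0], of "f x0 / 2"] fx0 by simp
    \<comment> \<open>The first bound turns \<open>x0\<close>, \<open>e'\<close> into a chord of
      rate \<open>l\<close>; the second makes the resulting tail bound \<open>g k e' / l\<close> at
      most a quarter of \<eta>.\<close>
    moreover have "\<forall>\<^sub>F k in sequentially. \<forall>x\<ge>e'. g k x < min (f x0 / 2 * exp (- 1)) (\<eta> / 4 * l)"
      using d e' fx0 \<eta> l by (intro eventually_small_beyond[OF db]) auto
    ultimately have "\<forall>\<^sub>F k in sequentially. (LBINT y:{t<..}. g k y) \<le> \<eta>"
    proof eventually_elim
      case (elim k)
      have ge: "g k e' < f x0 / 2 * exp (- 1)" "g k e' < \<eta> / 4 * l" using elim(3) by auto
      have "f x0 / 2 * exp (- 1) \<le> g k x0 * exp (- 1)" using elim(2) by simp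
      then have "g k e' \<le> g k x0 * exp (- 1)" using ge(1) by linarith
      then have dec: "g k e' \<le> g k x0 * exp (- l * (e' - x0))" using l by simp
      have "0 < g k x0" using elim(2) fx0 by linarith
      then have "(LBINT y:{e'<..}. g k y) \<le> g k e' / l"
        by (rule log_concave_tail[OF lcg gint xe' order_refl _ dec l(1)])
      also have "\<dots> \<le> \<eta> / 4" using ge l by (simp add: field_simps)
      finally have 1: "(LBINT y:{e'<..}. g k y) \<le> \<eta> / 4" .
      have un: "{t<..} = {t<..e'} \<union> {e'<..}" using te' by auto
      have "(LBINT y:{t<..}. g k y) = (LBINT y:{t<..e'}. g k y) + (LBINT y:{e'<..}. g k y)"
        unfolding un by (rule set_integral_Un) (auto intro: g_set_integrable)
      moreover have "(LBINT y:{t<..e'}. g k y) \<le> (LBINT y:{t..e'}. g k y)"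
        by (intro set_integral_mono_subset gint) auto
      ultimately show ?case using 1 elim(1) by linarith
    qed
    then show ?thesis using ct t d by auto
  qed
qed

text \<open>The chord of \<open>ln f\<close> from \<open>x0\<close> to \<open>e\<close> controls the exponential decay of \<open>g k\<close> to the right of \<open>e\<close>.\<close>

lemma eventually_tail_slope:
  assumes d: "d = ereal e" and fe: "0 < f e" and x0: "c < ereal x0" "x0 < e" and dec: "f e < f x0"
    and \<eta>: "0 < \<eta>"
  shows "\<exists>t. c < ereal t \<and> t < e \<and> (\<forall>\<^sub>F k in sequentially.
    (LBINT y:{t<..}. g k y) \<le> f e * (e - x0) / ln (f x0 / f e) + \<eta>)"
proof -
  define S where "S = ln (f x0 / f e) / (e - x0)"
  have fx0: "0 < f x0" using fe dec by simp
  have S: "0 < S" using x0 fe dec by (simp add: S_def)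
  have "S * (e - x0) = ln (f x0 / f e)" using x0 by (simp add: S_def)
  then have eS: "exp (- S * (e - x0)) = f e / f x0"
    using fx0 fe by (simp add: exp_minus)
  \<comment> \<open>Convergence of \<open>g k\<close> is known only to the left of \<open>e\<close>,
    so the chord has to end at some \<open>t < e\<close>. This costs \<open>s\<close> in the value
    and \<open>s\<close> in the slope \<open>S\<close>, a loss that disappears in the limit.\<close>
  have "((\<lambda>s. (f e + s) / (S - s)) \<longlongrightarrow> (f e + 0) / (S - 0)) (at_right 0)"
    using S by (intro tendsto_intros) auto
  then have "\<forall>\<^sub>F s in at_right 0. (f e + s) / (S - s) < f e / S + \<eta>"
    using \<eta> by (intro order_tendstoD(2)) auto
  moreover have "\<forall>\<^sub>F s in at_right 0. s < S"
    by (rule eventually_at_rightI[of 0 S]) (use S in auto)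
  moreover have "\<forall>\<^sub>F s in at_right 0. (0::real) < s" by (simp add: eventually_at_right_less)
  ultimately have "\<forall>\<^sub>F s in at_right 0. 0 < s \<and> s < S \<and> (f e + s) / (S - s) < f e / S + \<eta>"
    by eventually_elim auto
  then obtain s where s: "0 < s" "s < S" "(f e + s) / (S - s) < f e / S + \<eta>"
    using eventually_happens'[OF trivial_limit_at_right_real] by blast
  define l where "l = S - s"
  have l: "0 < l" using s by (simp add: l_def)
  have lim: "((\<lambda>t. f x0 * exp (- l * (t - x0)) - f t) \<longlongrightarrow> f x0 * exp (- l * (e - x0)) - f e) (at_left e)"
    by (intro tendsto_intros f_left_limit[OF d fe])
  have "f e = f x0 * exp (- S * (e - x0))" using eS fx0 by simp
  also have "\<dots> < f x0 * exp (- l * (e - x0))"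
  proof (rule mult_strict_left_mono[OF _ fx0])
    have "l * (e - x0) < S * (e - x0)" using x0 s by (intro mult_strict_right_mono) (auto simp: l_def)
    then show "exp (- S * (e - x0)) < exp (- l * (e - x0))" by (simp only: exp_less_cancel_iff mult_minus_left neg_less_iff_less)
  qed
  finally have "\<forall>\<^sub>F t in at_left e. 0 < f x0 * exp (- l * (t - x0)) - f t"
    by (intro order_tendstoD(1)[OF lim]) simp
  moreover have "\<forall>\<^sub>F t in at_left e. f t < f e + s"
    using order_tendstoD(2)[OF f_left_limit[OF d fe]] s by simp
  ultimately have "\<forall>\<^sub>F t in at_left e. 0 < f x0 * exp (- l * (t - x0)) - f t \<and> f t < f e + s"
    by eventually_elim auto
  then obtain t where t: "x0 < t" "c < ereal t" "t < e" "0 < f x0 * exp (- l * (t - x0)) - f t" "f t < f e + s"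
    by (rule eventually_at_left_inner[OF d]) (use x0 in auto)
  have td: "ereal t < d" and xd: "ereal x0 < d" using t x0 d by auto
  have "(\<lambda>k. g k x0 * exp (- l * (t - x0)) - g k t) \<longlonglongrightarrow> f x0 * exp (- l * (t - x0)) - f t"
    by (intro tendsto_intros pointwise x0 t td xd)
  then have "\<forall>\<^sub>F k in sequentially. 0 < g k x0 * exp (- l * (t - x0)) - g k t"
    using t(4) by (rule order_tendstoD(1))
  moreover have "\<forall>\<^sub>F k in sequentially. g k t < f e + s"
    using order_tendstoD(2)[OF pointwise[OF t(2) td] t(5)] .
  moreover have "\<forall>\<^sub>F k in sequentially. 0 < g k x0"
    using order_tendstoD(1)[OF pointwise[OF x0(1) xd] fx0] .
  ultimately have "\<forall>\<^sub>F k in sequentially. (LBINT y:{t<..}. g k y) \<le> f e / S + \<eta>"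
  proof eventually_elim
    case (elim k)
    have "(LBINT y:{t<..}. g k y) \<le> g k t / l"
      using elim t l by (intro log_concave_tail[OF lcg gint, of x0 t]) auto
    also have "\<dots> \<le> (f e + s) / l" using elim l by (intro divide_right_mono) auto
    also have "\<dots> \<le> f e / S + \<eta>" using s by (simp add: l_def)
    finally show ?case .
  qed
  then show ?thesis using t by (auto simp: S_def)
qed

text \<open>Below \<open>b\<close> no mass is concentrated near the end, even at a jump at
  \<open>d = b\<close>: extrapolation from two inner points bounds \<open>g k\<close> up to
  \<open>b\<close> by a constant \<open>C\<close>, so a short strip carries little.\<close>

lemma eventually_inner_tail_small:
  assumes \<eta>: "0 < \<eta>"
  shows "\<exists>t0. c < ereal t0 \<and> ereal t0 < d \<and>
    (\<forall>\<^sub>F k in sequentially. \<forall>t\<ge>t0. (LBINT y:{y. t < y \<and> ereal y < b}. g k y) \<le> \<eta>)"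
proof -
  have "\<exists>t0. c < ereal t0 \<and> ereal t0 < d \<and>
    (\<forall>\<^sub>F k in sequentially. (LBINT y:{y. t0 < y \<and> ereal y < b}. g k y) \<le> \<eta>)"
  proof (cases "vanishing_right \<or> d < b")
    case True
    then obtain t where t: "c < ereal t" "ereal t < d"
        "\<forall>\<^sub>F k in sequentially. (LBINT y:{t<..}. g k y) \<le> \<eta>"
      using eventually_tail_small[OF _ \<eta>] by blast
    have "(LBINT y:{y. t < y \<and> ereal y < b}. g k y) \<le> (LBINT y:{t<..}. g k y)" for k
      by (intro set_integral_mono_subset gint) auto
    then have "\<forall>\<^sub>F k in sequentially. (LBINT y:{y. t < y \<and> ereal y < b}. g k y) \<le> \<eta>"
      using t(3) by (auto elim!: eventually_mono intro: order_trans)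
    then show ?thesis using t by blast
  next
    case False
    then obtain e where d: "d = ereal e" and b: "b = ereal e"
      using vanishing_right_or_jump db by (metis order_le_imp_less_or_eq)
    obtain u where u: "c < ereal u" "ereal u < d" using ereal_dense2[OF cd] by blast
    define w where "w = (u + e) / 2"
    have uw: "u < w" "w < e" using u d by (auto simp: w_def)
    have w: "c < ereal w" "ereal w < d" using ereal_less_between(1)[OF u(1)] uw d by auto
    have fu: "0 < f u" using u fpos by auto
    define m where "m = f u / 2"
    \<comment> \<open>\<open>f w + 1\<close> eventually exceeds \<open>g k w\<close>; the maximum
      with \<open>m\<close> secures the hypothesis \<open>l \<le> M\<close> of
      \<open>log_concave_extrapolate_bound\<close>.\<close>
    define B where "B = max (f w + 1) m"
    define C where "C = B * B / m"
    have m: "0 < m" "m < f u" using fu by (auto simp: m_def)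
    have C: "0 \<le> C" using m by (simp add: C_def)
    define s where "s = \<eta> / (C + 1)"
    have s: "0 < s" "C * s \<le> \<eta>" using C \<eta> by (auto simp: s_def field_simps)
    define t where "t = max w (e - s)"
    have t: "w \<le> t" "t < e" "e - s \<le> t" using uw s by (auto simp: t_def)
    have "\<forall>\<^sub>F k in sequentially. m < g k u"
      using order_tendstoD(1)[OF pointwise[OF u] m(2)] .
    moreover have "\<forall>\<^sub>F k in sequentially. g k w < B"
      using order_tendstoD(2)[OF pointwise[OF w]] by (simp add: B_def)
    ultimately have "\<forall>\<^sub>F k in sequentially. (LBINT y:{y. t < y \<and> ereal y < b}. g k y) \<le> \<eta>"
    proof eventually_elim
      case (elim k)
      have "g k y \<le> C" if "y \<in> {t..e}" for y
        unfolding C_def using elim that t uw m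
        by (intro log_concave_extrapolate_bound[OF lcg, of u w]) (auto simp: B_def w_def field_simps)
      then have "(LBINT y:{t..e}. g k y) \<le> (LBINT y:{t..e}. C)"
        by (intro set_integral_mono g_set_integrable borel_integrable_atLeastAtMost') auto
      also have "\<dots> = C * (e - t)" using t by (intro set_integral_const_Icc) auto
      also have "\<dots> \<le> C * s" using C t by (intro mult_left_mono) auto
      finally have "(LBINT y:{t..e}. g k y) \<le> \<eta>" using s by simp
      moreover have "(LBINT y:{y. t < y \<and> ereal y < b}. g k y) \<le> (LBINT y:{t..e}. g k y)"
        by (intro set_integral_mono_subset gint) (auto simp: b)
      ultimately show ?case by simp
    qed
    then show ?thesis using t d ereal_less_between(1)[OF w(1) t(1)] by auto
  qed
  then obtain t0 where t0: "c < ereal t0" "ereal t0 < d"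
    "\<forall>\<^sub>F k in sequentially. (LBINT y:{y. t0 < y \<and> ereal y < b}. g k y) \<le> \<eta>" by blast
  have "(LBINT y:{y. t < y \<and> ereal y < b}. g k y) \<le> (LBINT y:{y. t0 < y \<and> ereal y < b}. g k y)"
    if "t0 \<le> t" for k t
    using that by (intro set_integral_mono_subset gint) auto
  then have "\<forall>\<^sub>F k in sequentially. \<forall>t\<ge>t0. (LBINT y:{y. t < y \<and> ereal y < b}. g k y) \<le> \<eta>"
    using t0(3) by (auto elim!: eventually_mono intro: order_trans)
  then show ?thesis using t0 by blast
qed

text \<open>At a jump, extrapolated bounds tend to \<open>f e\<close>, so the upper estimate extends
  up to \<open>e\<close> itself. Just to the right of \<open>e\<close> it may fail, since
  \<open>f\<close> drops to 0 while \<open>g k\<close> need not do so at once; \<open>gap\<close>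
  keeps \<open>S\<close> away from there.\<close>

lemma eventually_le_right:
  assumes \<eta>: "0 < \<eta>" and Sb: "\<And>x. x \<in> S \<Longrightarrow> ereal x \<le> b"
    and \<delta>: "0 < \<delta>" and gap: "\<And>x e. x \<in> S \<Longrightarrow> d = ereal e \<Longrightarrow> 0 < f e \<Longrightarrow> e < x \<Longrightarrow> e + \<delta> \<le> x"
  shows "\<exists>t0. c < ereal t0 \<and> ereal t0 < d \<and>
    (\<forall>\<^sub>F k in sequentially. \<forall>x\<in>S. t0 \<le> x \<longrightarrow> g k x \<le> f x + \<eta>)"
proof (cases rule: vanishing_right_or_jump)
  case vanishing
  obtain x0 where x0: "c < ereal x0" "ereal x0 < d" using ereal_dense2[OF cd] by blast
  have fx0: "0 < f x0" using x0 fpos by auto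
  obtain t where t: "x0 < t" "c < ereal t" "ereal t < d" "f t < min \<eta> (f x0 / 2)"
    using vanishing \<eta> fx0 x0 unfolding vanishing_right_def by (metis half_gt_zero min_less_iff_conj)
  have "\<forall>\<^sub>F k in sequentially. g k t < min \<eta> (f x0 / 2)"
    using order_tendstoD(2)[OF pointwise[OF t(2,3)] t(4)] .
  moreover have "\<forall>\<^sub>F k in sequentially. f x0 / 2 < g k x0"
    using order_tendstoD(1)[OF pointwise[OF x0], of "f x0 / 2"] fx0 by simp
  ultimately have "\<forall>\<^sub>F k in sequentially. \<forall>x\<in>S. t \<le> x \<longrightarrow> g k x \<le> f x + \<eta>"
  proof eventually_elim
    case (elim k)
    show ?case
    proof (intro ballI impI)
      fix x assume "t \<le> x"
      then have "min (g k x0) (g k x) \<le> g k t" using t by (intro log_concave_min[OF lcg]) auto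
      then have "g k x < \<eta>" using elim by auto
      then show "g k x \<le> f x + \<eta>" using f_nonneg[of x] by linarith
    qed
  qed
  then show ?thesis using t by blast
next
  case (jump e)
  \<comment> \<open>As in \<open>locally_uniform\<close>: the extrapolated bound with values within
    \<open>s\<close> of \<open>f e\<close>, plus the oscillation \<open>s\<close> of
    \<open>f\<close> to the left of \<open>e\<close>.\<close>
  have "((\<lambda>s. (f e + s) * (f e + s) / (f e - s) + s) \<longlongrightarrow> (f e + 0) * (f e + 0) / (f e - 0) + 0) (at_right 0)"
    using jump by (intro tendsto_intros) auto
  then have "\<forall>\<^sub>F s in at_right 0. (f e + s) * (f e + s) / (f e - s) + s < f e + \<eta>"
    using \<eta> jump by (intro order_tendstoD(2)) auto
  moreover have "\<forall>\<^sub>F s in at_right 0. s < f e"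
    by (rule eventually_at_rightI[of 0 "f e"]) (use jump in auto)
  moreover have "\<forall>\<^sub>F s in at_right 0. (0::real) < s" by (simp add: eventually_at_right_less)
  ultimately have "\<forall>\<^sub>F s in at_right 0. 0 < s \<and> s < f e \<and> (f e + s) * (f e + s) / (f e - s) + s < f e + \<eta>"
    by eventually_elim auto
  then obtain s where s: "0 < s" "s < f e" "(f e + s) * (f e + s) / (f e - s) + s < f e + \<eta>"
    using eventually_happens'[OF trivial_limit_at_right_real] by blast
  have "\<forall>\<^sub>F t in at_left e. f e - s < f t \<and> f t < f e + s"
    using order_tendstoD[OF f_left_limit[OF jump]] s by (intro eventually_conj) auto
  then obtain u where u: "c < ereal u" "u < e" "\<And>x. u \<le> x \<Longrightarrow> x < e \<Longrightarrow> f e - s < f x \<and> f x < f e + s"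
    by (rule eventually_at_left_inner[OF jump(1), of _ "e - 1"]) auto
  define w where "w = (u + e) / 2"
  have uw: "u < w" "w < e" using u by (auto simp: w_def)
  have ud: "ereal u < d" and w: "c < ereal w" "ereal w < d"
    using ereal_less_between(1)[OF u(1)] u uw jump by auto
  have "\<forall>\<^sub>F k in sequentially. f e - s < g k u"
    using order_tendstoD(1)[OF pointwise[OF u(1) ud]] u(3)[of u] u(2) by auto
  moreover have "\<forall>\<^sub>F k in sequentially. g k w < f e + s"
    using order_tendstoD(2)[OF pointwise[OF w]] u(3)[of w] uw by auto
  \<comment> \<open>Points of \<open>S\<close> beyond \<open>e\<close> exist only if
    \<open>d < b\<close>, and only then does convergence give control beyond
    \<open>e\<close>.\<close>
  moreover have "\<forall>\<^sub>F k in sequentially. \<forall>x\<ge>e + \<delta>. d < b \<longrightarrow> g k x < \<eta>"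
    using eventually_small_beyond[of "e + \<delta>", OF _ _ \<eta>] \<delta> jump(1) by (cases "d < b") auto
  ultimately have "\<forall>\<^sub>F k in sequentially. \<forall>x\<in>S. w \<le> x \<longrightarrow> g k x \<le> f x + \<eta>"
  proof eventually_elim
    case (elim k)
    show ?case
    proof (intro ballI impI)
      fix x assume x: "x \<in> S" "w \<le> x"
      show "g k x \<le> f x + \<eta>"
      proof (cases "x \<le> e")
        case True
        have fx: "f e - s < f x" using u(3)[of x] True x uw s by (cases "x = e") auto
        have "g k x \<le> (f e + s) * (f e + s) / (f e - s)"
          using elim x True uw s
          by (intro log_concave_extrapolate_bound[OF lcg, of u w]) (auto simp: w_def field_simps)
        then show ?thesis using fx s by linarith
      next
        case False
        then have "e + \<delta> \<le> x" using gap[OF x(1) jump] by simp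
        moreover have "d < b" using False Sb[OF x(1)] jump by (simp add: less_le_trans[of "ereal e" "ereal x"])
        ultimately have "g k x < \<eta>" using elim by blast
        then show ?thesis using f_nonneg[of x] by linarith
      qed
    qed
  qed
  then show ?thesis using w by blast
qed

text \<open>Serves the lower bounds, where near \<open>d\<close> only \<open>0 \<le> g k x\<close>
  is used. So \<open>f\<close> itself has to be small there, and at a jump \<open>S\<close> has to
  avoid the inner side too.\<close>

lemma f_small_right:
  assumes \<eta>: "0 < \<eta>" and Sb: "\<And>x. x \<in> S \<Longrightarrow> ereal x \<le> b"
    and \<delta>: "0 < \<delta>" and gap: "\<And>x e. x \<in> S \<Longrightarrow> d = ereal e \<Longrightarrow> 0 < f e \<Longrightarrow> x \<le> e - \<delta> \<or> (e < x \<and> f x = 0)"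
  shows "\<exists>t0. c < ereal t0 \<and> ereal t0 < d \<and> (\<forall>x\<in>S. t0 < x \<longrightarrow> f x \<le> \<eta>)"
proof (cases rule: vanishing_right_or_jump)
  case vanishing
  obtain x0 where x0: "c < ereal x0" "ereal x0 < d" using ereal_dense2[OF cd] by blast
  have fx0: "0 < f x0" using x0 fpos by auto
  obtain t where t: "x0 < t" "c < ereal t" "ereal t < d" "f t < min \<eta> (f x0)"
    using vanishing \<eta> fx0 x0 unfolding vanishing_right_def by (metis min_less_iff_conj)
  have "f x \<le> \<eta>" if "t < x" for x
    using log_concave_min[OF lcf, of x0 t x] t that by auto
  then show ?thesis using t by blast
next
  case (jump e)
  have "ereal (e - \<delta>) < d" using jump \<delta> by simp
  then obtain t where t: "e - \<delta> < t" "c < ereal t" "ereal t < d" using inner_point by blast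
  have "f x \<le> \<eta>" if "x \<in> S" "t < x" for x
    using gap[OF that(1) jump] that t \<eta> by auto
  then show ?thesis using t by blast
qed

section \<open>Both ends of the support and convergence in mean\<close>


lemma eventually_le_left:
  assumes \<eta>: "0 < \<eta>" and Sa: "\<And>x. x \<in> S \<Longrightarrow> a \<le> ereal x"
    and \<delta>: "0 < \<delta>" and gap: "\<And>x e. x \<in> S \<Longrightarrow> c = ereal e \<Longrightarrow> 0 < f e \<Longrightarrow> x < e \<Longrightarrow> x \<le> e - \<delta>"
  shows "\<exists>s0. c < ereal s0 \<and> ereal s0 < d \<and>
    (\<forall>\<^sub>F k in sequentially. \<forall>x\<in>S. x \<le> s0 \<longrightarrow> g k x \<le> f x + \<eta>)"
proof -
  interpret r: log_concave_seq "\<lambda>k x. g k (- x)" "\<lambda>x. f (- x)" "- b" "- a" "- d" "- c"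
    by (rule reflect)
  have "\<exists>t0. - d < ereal t0 \<and> ereal t0 < - c \<and>
    (\<forall>\<^sub>F k in sequentially. \<forall>x\<in>uminus ` S. t0 \<le> x \<longrightarrow> g k (- x) \<le> f (- x) + \<eta>)"
  proof (rule r.eventually_le_right[OF \<eta> _ \<delta>])
    fix x assume "x \<in> uminus ` S"
    then show "ereal x \<le> - a" using Sa[of "- x"] by (cases a) auto
  next
    fix x e assume "x \<in> uminus ` S" "- c = ereal e" "0 < f (- e)" "e < x"
    then show "e + \<delta> \<le> x" using gap[of "- x" "- e"] by (cases c) auto
  qed
  then obtain t0 where t0: "- d < ereal t0" "ereal t0 < - c"
    "\<forall>\<^sub>F k in sequentially. \<forall>x\<in>uminus ` S. t0 \<le> x \<longrightarrow> g k (- x) \<le> f (- x) + \<eta>" by blast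
  show ?thesis
  proof (intro exI[of _ "- t0"] conjI)
    show "c < ereal (- t0)" "ereal (- t0) < d"
      using t0 by (simp_all add: ereal_less_uminus_reorder ereal_uminus_less_reorder flip: uminus_ereal.simps(1))
    show "\<forall>\<^sub>F k in sequentially. \<forall>x\<in>S. x \<le> - t0 \<longrightarrow> g k x \<le> f x + \<eta>"
      using t0(3) by eventually_elim auto
  qed
qed

lemma f_small_left:
  assumes \<eta>: "0 < \<eta>" and Sa: "\<And>x. x \<in> S \<Longrightarrow> a \<le> ereal x"
    and \<delta>: "0 < \<delta>" and gap: "\<And>x e. x \<in> S \<Longrightarrow> c = ereal e \<Longrightarrow> 0 < f e \<Longrightarrow> e + \<delta> \<le> x \<or> (x < e \<and> f x = 0)"
  shows "\<exists>s0. c < ereal s0 \<and> ereal s0 < d \<and> (\<forall>x\<in>S. x < s0 \<longrightarrow> f x \<le> \<eta>)"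
proof -
  interpret r: log_concave_seq "\<lambda>k x. g k (- x)" "\<lambda>x. f (- x)" "- b" "- a" "- d" "- c"
    by (rule reflect)
  have "\<exists>t0. - d < ereal t0 \<and> ereal t0 < - c \<and> (\<forall>x\<in>uminus ` S. t0 < x \<longrightarrow> f (- x) \<le> \<eta>)"
  proof (rule r.f_small_right[OF \<eta> _ \<delta>])
    fix x assume "x \<in> uminus ` S"
    then show "ereal x \<le> - a" using Sa[of "- x"] by (cases a) auto
  next
    fix x e assume "x \<in> uminus ` S" "- c = ereal e" "0 < f (- e)"
    then show "x \<le> e - \<delta> \<or> e < x \<and> f (- x) = 0" using gap[of "- x" "- e"] by (cases c) auto
  qed
  then obtain t0 where t0: "- d < ereal t0" "ereal t0 < - c"
    "\<forall>x\<in>uminus ` S. t0 < x \<longrightarrow> f (- x) \<le> \<eta>" by blast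
  show ?thesis
  proof (intro exI[of _ "- t0"] conjI)
    show "c < ereal (- t0)" "ereal (- t0) < d"
      using t0 by (simp_all add: ereal_less_uminus_reorder ereal_uminus_less_reorder flip: uminus_ereal.simps(1))
    show "\<forall>x\<in>S. x < - t0 \<longrightarrow> f x \<le> \<eta>" using t0(3) by auto
  qed
qed

lemma eventually_inner_left_tail_small:
  assumes \<eta>: "0 < \<eta>"
  shows "\<exists>s0. c < ereal s0 \<and> ereal s0 < d \<and>
    (\<forall>\<^sub>F k in sequentially. \<forall>s\<le>s0. (LBINT y:{y. a < ereal y \<and> y < s}. g k y) \<le> \<eta>)"
proof -
  interpret r: log_concave_seq "\<lambda>k x. g k (- x)" "\<lambda>x. f (- x)" "- b" "- a" "- d" "- c"
    by (rule reflect)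
  obtain t0 where t0: "- d < ereal t0" "ereal t0 < - c"
    "\<forall>\<^sub>F k in sequentially. \<forall>t\<ge>t0. (LBINT y:{y. t < y \<and> ereal y < - a}. g k (- y)) \<le> \<eta>"
    using r.eventually_inner_tail_small[OF \<eta>] by blast
  have refl: "(LBINT y:{y. - s < y \<and> ereal y < - a}. g k (- y)) = (LBINT y:{y. a < ereal y \<and> y < s}. g k y)" for s k
    by (subst set_integral_reflect)
      (auto intro!: arg_cong2[where f="set_lebesgue_integral lborel"]
        simp: ereal_less_uminus_reorder ereal_uminus_less_reorder simp flip: uminus_ereal.simps(1))
  show ?thesis
  proof (intro exI[of _ "- t0"] conjI)
    show "c < ereal (- t0)" "ereal (- t0) < d"
      using t0 by (simp_all add: ereal_less_uminus_reorder ereal_uminus_less_reorder flip: uminus_ereal.simps(1))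
    show "\<forall>\<^sub>F k in sequentially. \<forall>s\<le>- t0. (LBINT y:{y. a < ereal y \<and> y < s}. g k y) \<le> \<eta>"
      using t0(3)
    proof eventually_elim
      case (elim k)
      show ?case
      proof (intro allI impI)
        fix s assume "s \<le> - t0"
        then have "t0 \<le> - s" by simp
        with elim show "(LBINT y:{y. a < ereal y \<and> y < s}. g k y) \<le> \<eta>"
          unfolding refl[symmetric] by blast
      qed
    qed
  qed
qed

lemma eventually_upper:
  assumes \<eta>: "0 < \<eta>" and Sab: "\<And>x. x \<in> S \<Longrightarrow> a \<le> ereal x \<and> ereal x \<le> b" and \<delta>: "0 < \<delta>"
    and gapL: "\<And>x e. x \<in> S \<Longrightarrow> c = ereal e \<Longrightarrow> 0 < f e \<Longrightarrow> x < e \<Longrightarrow> x \<le> e - \<delta>"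
    and gapR: "\<And>x e. x \<in> S \<Longrightarrow> d = ereal e \<Longrightarrow> 0 < f e \<Longrightarrow> e < x \<Longrightarrow> e + \<delta> \<le> x"
  shows "\<forall>\<^sub>F k in sequentially. \<forall>x\<in>S. g k x \<le> f x + \<eta>"
proof -
  obtain s where s: "c < ereal s" "\<forall>\<^sub>F k in sequentially. \<forall>x\<in>S. x \<le> s \<longrightarrow> g k x \<le> f x + \<eta>"
    using eventually_le_left[OF \<eta> _ \<delta> gapL, of S] Sab by auto
  obtain t where t: "ereal t < d" "\<forall>\<^sub>F k in sequentially. \<forall>x\<in>S. t \<le> x \<longrightarrow> g k x \<le> f x + \<eta>"
    using eventually_le_right[OF \<eta> _ \<delta> gapR, of S] Sab by auto
  show ?thesis
    using s(2) t(2) uniform_compact[OF s(1) t(1) \<eta>]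
  proof eventually_elim
    case (elim k)
    show ?case
    proof
      fix x assume x: "x \<in> S"
      consider "x \<le> s" | "t \<le> x" | "x \<in> {s..t}" by fastforce
      then show "g k x \<le> f x + \<eta>"
      proof cases
        case 3
        then have "\<bar>g k x - f x\<bar> < \<eta>" using elim by blast
        then show ?thesis by linarith
      qed (use elim x in auto)
    qed
  qed
qed

lemma eventually_lower:
  assumes \<eta>: "0 < \<eta>" and Sab: "\<And>x. x \<in> S \<Longrightarrow> a \<le> ereal x \<and> ereal x \<le> b" and \<delta>: "0 < \<delta>"
    and gapL: "\<And>x e. x \<in> S \<Longrightarrow> c = ereal e \<Longrightarrow> 0 < f e \<Longrightarrow> e + \<delta> \<le> x \<or> (x < e \<and> f x = 0)"
    and gapR: "\<And>x e. x \<in> S \<Longrightarrow> d = ereal e \<Longrightarrow> 0 < f e \<Longrightarrow> x \<le> e - \<delta> \<or> (e < x \<and> f x = 0)"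
  shows "\<forall>\<^sub>F k in sequentially. \<forall>x\<in>S. f x \<le> g k x + \<eta>"
proof -
  obtain s where s: "c < ereal s" "\<forall>x\<in>S. x < s \<longrightarrow> f x \<le> \<eta>"
    using f_small_left[OF \<eta> _ \<delta> gapL, of S] Sab by auto
  obtain t where t: "ereal t < d" "\<forall>x\<in>S. t < x \<longrightarrow> f x \<le> \<eta>"
    using f_small_right[OF \<eta> _ \<delta> gapR, of S] Sab by auto
  show ?thesis
    using uniform_compact[OF s(1) t(1) \<eta>]
  proof eventually_elim
    case (elim k)
    show ?case
    proof
      fix x assume x: "x \<in> S"
      consider "x < s" | "t < x" | "x \<in> {s..t}" by fastforce
      then show "f x \<le> g k x + \<eta>"
      proof cases
        case 1
        then have "f x \<le> \<eta>" using s(2) x by blast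
        then show ?thesis using g_nonneg[of k x] by linarith
      next
        case 2
        then have "f x \<le> \<eta>" using t(2) x by blast
        then show ?thesis using g_nonneg[of k x] by linarith
      next
        case 3
        then have "\<bar>g k x - f x\<bar> < \<eta>" using elim by blast
        then show ?thesis by linarith
      qed
    qed
  qed
qed

text \<open>On a compact part \<open>{s..t}\<close> of the support convergence is uniform; outside
  it the integrand is at most \<open>g k x + f x\<close>, whose tails inside \<open>(a,b)\<close>
  are small at both ends.\<close>

lemma eventually_L1:
  assumes \<eta>: "0 < \<eta>"
  shows "\<forall>\<^sub>F k in sequentially. (LBINT x:einterval a b. \<bar>g k x - f x\<bar>) \<le> \<eta>"
proof -
  interpret cf: log_concave_seq "\<lambda>k. f" f a b c d by (rule const)
  \<comment> \<open>Two tails of \<open>g k\<close>, two of \<open>f\<close>, and the compact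
    part.\<close>
  define \<eta>' where "\<eta>' = \<eta> / 5"
  have \<eta>': "0 < \<eta>'" using \<eta> by (simp add: \<eta>'_def)
  obtain t1 where t1: "c < ereal t1" "ereal t1 < d"
    "\<forall>\<^sub>F k in sequentially. \<forall>t\<ge>t1. (LBINT y:{y. t < y \<and> ereal y < b}. g k y) \<le> \<eta>'"
    using eventually_inner_tail_small[OF \<eta>'] by blast
  obtain t2 where t2: "c < ereal t2" "ereal t2 < d"
    "\<forall>t\<ge>t2. (LBINT y:{y. t < y \<and> ereal y < b}. f y) \<le> \<eta>'"
    using cf.eventually_inner_tail_small[OF \<eta>'] by auto
  obtain s1 where s1: "c < ereal s1" "ereal s1 < d"
    "\<forall>\<^sub>F k in sequentially. \<forall>s\<le>s1. (LBINT y:{y. a < ereal y \<and> y < s}. g k y) \<le> \<eta>'"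
    using eventually_inner_left_tail_small[OF \<eta>'] by blast
  obtain s2 where s2: "c < ereal s2" "ereal s2 < d"
    "\<forall>s\<le>s2. (LBINT y:{y. a < ereal y \<and> y < s}. f y) \<le> \<eta>'"
    using cf.eventually_inner_left_tail_small[OF \<eta>'] by auto
  define t where "t = max t1 t2"
  define s where "s = min (min s1 s2) t"
  have st: "s \<le> t" "s \<le> s1" "s \<le> s2" "t1 \<le> t" "t2 \<le> t" by (auto simp: s_def t_def)
  have t: "c < ereal t" "ereal t < d" using t1 t2 by (auto simp: t_def max_def)
  have s: "c < ereal s" using s1 s2 t by (auto simp: s_def min_def)
  \<comment> \<open>The added 1 admits the degenerate case \<open>s = t\<close>.\<close>
  define z where "z = \<eta>' / (t - s + 1)"
  have z: "0 < z" "z * (t - s) \<le> \<eta>'" using \<eta>' st by (auto simp: z_def field_simps)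
  let ?L = "{y. a < ereal y \<and> y < s}" and ?R = "{y. t < y \<and> ereal y < b}"
  show ?thesis
    using t1(3) s1(3) uniform_compact[OF s t(2) z(1)]
  proof eventually_elim
    case (elim k)
    have ind: "indicator (einterval a b) x *\<^sub>R \<bar>g k x - f x\<bar> \<le>
      (indicator ?L x *\<^sub>R g k x + indicator ?L x *\<^sub>R f x + indicator {s..t} x *\<^sub>R z) +
      (indicator ?R x *\<^sub>R g k x + indicator ?R x *\<^sub>R f x)" for x
    proof -
      have le: "\<bar>g k x - f x\<bar> \<le> g k x + f x" using g_nonneg[of k x] f_nonneg[of x] by linarith
      consider "x < s" | "t < x" | "x \<in> {s..t}" by fastforce
      then show ?thesis
      proof cases
        case 1
        then show ?thesis using le st by (auto simp: einterval_def split: split_indicator)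
      next
        case 2
        then show ?thesis using le st by (auto simp: einterval_def split: split_indicator)
      next
        case 3
        then have "\<bar>g k x - f x\<bar> \<le> z" using elim by force
        then show ?thesis using 3 z by (auto simp: einterval_def split: split_indicator)
      qed
    qed
    have m: "?L \<in> sets borel" "?R \<in> sets borel" by auto
    have i: "integrable lborel (\<lambda>x. indicator ?L x *\<^sub>R g k x)" "integrable lborel (\<lambda>x. indicator ?L x *\<^sub>R f x)"
      "integrable lborel (\<lambda>x. indicator ?R x *\<^sub>R g k x)" "integrable lborel (\<lambda>x. indicator ?R x *\<^sub>R f x)"
      using g_set_integrable[OF m(1)] g_set_integrable[OF m(2)] f_set_integrable[OF m(1)] f_set_integrable[OF m(2)]
      by (auto simp: set_integrable_def)
    have iz: "integrable lborel (\<lambda>x. indicator {s..t} x *\<^sub>R z)"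
      using borel_integrable_atLeastAtMost'[of s t "\<lambda>x. z"] by (simp add: set_integrable_def)
    have "(LBINT x:einterval a b. \<bar>g k x - f x\<bar>) \<le>
      (LBINT x. (indicator ?L x *\<^sub>R g k x + indicator ?L x *\<^sub>R f x + indicator {s..t} x *\<^sub>R z) +
      (indicator ?R x *\<^sub>R g k x + indicator ?R x *\<^sub>R f x))"
      unfolding set_lebesgue_integral_def
    proof (rule integral_mono)
      show "integrable lborel (\<lambda>x. indicator (einterval a b) x *\<^sub>R \<bar>g k x - f x\<bar>)"
        by (rule integrable_mult_indicator) (use gint fint in auto)
    qed (use i iz ind in auto)
    also have "\<dots> = (LBINT x:?L. g k x) + (LBINT x:?L. f x) + (LBINT x:{s..t}. z) + ((LBINT x:?R. g k x) + (LBINT x:?R. f x))"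
      unfolding set_lebesgue_integral_def using i iz by (simp add: integral_add)
    also have "\<dots> \<le> \<eta>' + \<eta>' + \<eta>' + (\<eta>' + \<eta>')"
    proof (intro add_mono)
      show "(LBINT x:{s..t}. z) \<le> \<eta>'" using set_integral_const_Icc[OF st(1)] z by simp
    qed (use elim s2(3) t2(3) st in auto)
    also have "\<dots> = \<eta>" by (simp add: \<eta>'_def)
    finally show ?case .
  qed
qed


text \<open>Extends \<open>fzero_right\<close> to the point \<open>b\<close>: a positive value there
  would, together with one inside the support, force positive values in between.\<close>

lemma f_zero_beyond:
  assumes d: "d < ereal y" and y: "ereal y \<le> b" and db: "d < b"
  shows "f y = 0"
proof (rule ccontr)
  assume "f y \<noteq> 0"
  then have fy: "0 < f y" using f_nonneg[of y] by linarith
  obtain x0 where x0: "c < ereal x0" "ereal x0 < d" using ereal_dense2[OF cd] by blast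
  obtain z where z: "d < ereal z" "ereal z < ereal y" using ereal_dense2[OF d] by blast
  have "f z = 0" using z less_le_trans[OF z(2) y] by (intro fzero_right)
  moreover have "min (f x0) (f y) \<le> f z"
  proof (rule log_concave_min[OF lcf])
    show "x0 \<le> z" using less_trans[OF x0(2) z(1)] by simp
  qed (use z in auto)
  ultimately show False using fy fpos[OF x0] by auto
qed

section \<open>Points of \<open>C_set\<close> and \<open>D_set\<close> near a jump\<close>

lemma C_set_reflect: "x \<in> C_set f a b \<delta> \<Longrightarrow> - x \<in> C_set (\<lambda>y. f (- y)) (- b) (- a) \<delta>"
  and D_set_reflect: "x \<in> D_set f a b \<delta> \<Longrightarrow> - x \<in> D_set (\<lambda>y. f (- y)) (- b) (- a) \<delta>"
proof -
  have cont: "continuous_on {- x - \<delta><..<- x + \<delta>} (\<lambda>y. h (- y))"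
    if "continuous_on {x - \<delta><..<x + \<delta>} h" for h :: "real \<Rightarrow> real"
    by (rule continuous_on_compose2[OF that]) (auto intro!: continuous_intros)
  have ab: "a \<le> ereal x \<and> ereal x \<le> b \<longleftrightarrow> - b \<le> ereal (- x) \<and> ereal (- x) \<le> - a"
    by (cases a; cases b) auto
  show "- x \<in> C_set (\<lambda>y. f (- y)) (- b) (- a) \<delta>" if "x \<in> C_set f a b \<delta>"
    using that ab cont[of f] by (auto simp: C_set_def)
  have ind: "indicator (einterval a b) (- y) = (indicator (einterval (- b) (- a)) y :: real)" for y
    by (cases a; cases b) (auto simp: einterval_def split: split_indicator)
  show "- x \<in> D_set (\<lambda>y. f (- y)) (- b) (- a) \<delta>" if "x \<in> D_set f a b \<delta>"
    using that ab cont[of "\<lambda>y. indicator (einterval a b) y * f y"] by (auto simp: D_set_def ind)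
qed

text \<open>To the right of the jump \<open>f x = 0\<close>, so membership of \<open>x\<close> means
  continuity of \<open>f\<close> within \<delta> of \<open>x\<close>. That neighbourhood cannot
  contain \<open>e\<close>, where \<open>f\<close> drops from \<open>f e > 0\<close> to 0.\<close>

lemma C_set_gap_right:
  assumes x: "x \<in> C_set f a b \<delta>" and d: "d = ereal e" and fe: "0 < f e" and ex: "e < x"
  shows "e + \<delta> \<le> x"
proof (rule ccontr)
  assume "\<not> e + \<delta> \<le> x"
  then have e: "e \<in> {x - \<delta><..<x + \<delta>}" using ex by auto
  have xb: "ereal x \<le> b" using x by (simp add: C_set_def)
  have db: "d < b" using xb ex d by (cases b) auto
  have zero: "f y = 0" if "e < y" "y \<le> x" for y
  proof (rule f_zero_beyond[OF _ _ db])
    show "ereal y \<le> b" using order_trans[of "ereal y" "ereal x" b] that xb by simp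
  qed (use that d in auto)
  then have "continuous_on {x - \<delta><..<x + \<delta>} f" using x ex by (auto simp: C_set_def)
  then have "isCont f e" using e continuous_on_eq_continuous_at[OF open_greaterThanLessThan] by blast
  then have lim: "(f \<longlongrightarrow> f e) (at_right e)" by (auto simp: isCont_def filterlim_at_split)
  have "\<forall>\<^sub>F y in at_right e. f y = 0"
    by (rule eventually_at_rightI[OF _ ex]) (use zero in auto)
  then have "((\<lambda>y. 0::real) \<longlongrightarrow> f e) (at_right e)" by (rule Lim_transform_eventually[OF lim])
  then show False using fe by (simp add: tendsto_const_iff)
qed

text \<open>The truncated function jumps at \<open>e\<close> in either case: if \<open>e < b\<close>
  because \<open>f\<close> vanishes to the right, if \<open>e = b\<close> because the indicator
  does. Hence \<open>e\<close> is kept at distance \<delta> on both sides.\<close>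

lemma D_set_gap_right:
  assumes x: "x \<in> D_set f a b \<delta>" and d: "d = ereal e" and fe: "0 < f e"
  shows "x \<le> e - \<delta> \<or> e + \<delta> \<le> x"
proof (rule ccontr)
  assume "\<not> (x \<le> e - \<delta> \<or> e + \<delta> \<le> x)"
  then have e: "e \<in> {x - \<delta><..<x + \<delta>}" by auto
  define h where "h = (\<lambda>y. indicator (einterval a b) y * f y)"
  have "continuous_on {x - \<delta><..<x + \<delta>} h" using x by (simp add: D_set_def h_def)
  then have "isCont h e" using e continuous_on_eq_continuous_at[OF open_greaterThanLessThan] by blast
  then have lim: "(h \<longlongrightarrow> h e) (at_left e)" "(h \<longlongrightarrow> h e) (at_right e)"
    by (auto simp: isCont_def filterlim_at_split)
  obtain u where u: "c < ereal u" "ereal u < d" using ereal_dense2[OF cd] by blast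
  have ue: "u < e" using u d by simp
  have eq: "h y = f y" if "y \<in> {u<..<e}" for y
  proof -
    have "a < ereal y" using that u(1) ac ereal_less_between(1)[of c u y] by (auto intro: le_less_trans)
    moreover have "ereal y < b" using that d db by (auto intro: less_le_trans[of _ "ereal e"])
    ultimately show ?thesis by (simp add: h_def einterval_def)
  qed
  have "\<forall>\<^sub>F y in at_left e. h y = f y" by (rule eventually_at_leftI[OF _ ue]) (rule eq)
  then have "(f \<longlongrightarrow> h e) (at_left e)" by (rule Lim_transform_eventually[OF lim(1)])
  \<comment> \<open>The left limit is positive, so continuity forces the indicator to be 1 at
    \<open>e\<close>, that is, \<open>e < b\<close>.\<close>
  then have he: "h e = f e"
    using f_left_limit[OF d fe] tendsto_unique[OF trivial_limit_at_left_real] by blast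
  then have "ereal e < b" using fe by (auto simp: h_def einterval_def split: split_indicator_asm)
  then obtain v where v: "ereal e < ereal v" "ereal v < b" using ereal_dense2 by blast
  have z: "h y = 0" if "y \<in> {e<..<v}" for y
    using that v d ereal_less_between(2)[of v b y] by (simp add: h_def fzero_right)
  have ev: "e < v" using v by simp
  have "\<forall>\<^sub>F y in at_right e. h y = 0" by (rule eventually_at_rightI[OF _ ev]) (rule z)
  then have "((\<lambda>y. 0::real) \<longlongrightarrow> h e) (at_right e)" by (rule Lim_transform_eventually[OF lim(2)])
  then show False using fe he by (simp add: tendsto_const_iff)
qed

lemma D_set_right_zero:
  assumes x: "x \<in> D_set f a b \<delta>" and d: "d = ereal e" and ex: "e < x"
  shows "f x = 0"
proof (rule f_zero_beyond)
  show xb: "ereal x \<le> b" using x by (simp add: D_set_def)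
  show "d < b" using xb ex d by (cases b) auto
qed (use ex d in simp)

lemma C_set_gap_left:
  assumes "x \<in> C_set f a b \<delta>" "c = ereal e" "0 < f e" "x < e"
  shows "x \<le> e - \<delta>"
proof -
  interpret r: log_concave_seq "\<lambda>k x. g k (- x)" "\<lambda>x. f (- x)" "- b" "- a" "- d" "- c"
    by (rule reflect)
  show ?thesis using r.C_set_gap_right[OF C_set_reflect[OF assms(1)], of "- e"] assms by simp
qed

lemma D_set_gap_left:
  assumes "x \<in> D_set f a b \<delta>" "c = ereal e" "0 < f e"
  shows "x \<le> e - \<delta> \<or> e + \<delta> \<le> x"
proof -
  interpret r: log_concave_seq "\<lambda>k x. g k (- x)" "\<lambda>x. f (- x)" "- b" "- a" "- d" "- c"
    by (rule reflect)
  show ?thesis using r.D_set_gap_right[OF D_set_reflect[OF assms(1)], of "- e"] assms by auto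
qed

lemma D_set_left_zero:
  assumes "x \<in> D_set f a b \<delta>" "c = ereal e" "x < e"
  shows "f x = 0"
proof -
  interpret r: log_concave_seq "\<lambda>k x. g k (- x)" "\<lambda>x. f (- x)" "- b" "- a" "- d" "- c"
    by (rule reflect)
  show ?thesis using r.D_set_right_zero[OF D_set_reflect[OF assms(1)], of "- e"] assms by auto
qed

lemma eventually_C_set:
  assumes "0 < \<eta>" "0 < \<delta>"
  shows "\<forall>\<^sub>F k in sequentially. \<forall>x\<in>C_set f a b \<delta>. g k x \<le> f x + \<eta>"
  using C_set_gap_left C_set_gap_right
  by (intro eventually_upper[OF assms(1) _ assms(2)]) (auto simp: C_set_def)

lemma eventually_D_set:
  assumes \<eta>: "0 < \<eta>" and \<delta>: "0 < \<delta>"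
  shows "\<forall>\<^sub>F k in sequentially. \<forall>x\<in>D_set f a b \<delta>. \<bar>g k x - f x\<bar> \<le> \<eta>"
proof -
  have gapR: "x \<le> e - \<delta> \<or> (e < x \<and> f x = 0)" "e < x \<Longrightarrow> e + \<delta> \<le> x"
    if "x \<in> D_set f a b \<delta>" "d = ereal e" "0 < f e" for x e
    using D_set_gap_right[OF that] D_set_right_zero[OF that(1,2)] \<delta> by auto
  have gapL: "e + \<delta> \<le> x \<or> (x < e \<and> f x = 0)" "x < e \<Longrightarrow> x \<le> e - \<delta>"
    if "x \<in> D_set f a b \<delta>" "c = ereal e" "0 < f e" for x e
    using D_set_gap_left[OF that] D_set_left_zero[OF that(1,2)] \<delta> by auto
  have ab: "a \<le> ereal x \<and> ereal x \<le> b" if "x \<in> D_set f a b \<delta>" for x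
    using that by (simp add: D_set_def)
  have "\<forall>\<^sub>F k in sequentially. \<forall>x\<in>D_set f a b \<delta>. g k x \<le> f x + \<eta>"
    by (rule eventually_upper[OF \<eta> ab \<delta> gapL(2) gapR(2)])
  moreover have "\<forall>\<^sub>F k in sequentially. \<forall>x\<in>D_set f a b \<delta>. f x \<le> g k x + \<eta>"
    by (rule eventually_lower[OF \<eta> ab \<delta> gapL(1) gapR(1)])
  ultimately show ?thesis
    by eventually_elim (auto simp: abs_le_iff algebra_simps)
qed

end

section \<open>Densities and distribution functions from the parameter space\<close>

lemma dens_nonneg [simp]: "0 \<le> dens \<psi> x"
  by (simp add: dens_def exp_ext_def)

lemma dens_pos_iff: "(\<psi>, r) \<in> Theta \<Longrightarrow> 0 < dens \<psi> x \<longleftrightarrow> \<psi> x \<noteq> - \<infinity>"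
  by (simp add: dens_def exp_ext_def)

lemma Theta_eq_ln_dens:
  assumes "(\<psi>, r) \<in> Theta" "0 < dens \<psi> x"
  shows "\<psi> x = ereal (ln (dens \<psi> x))"
proof -
  have "\<psi> x \<noteq> \<infinity>" "\<psi> x \<noteq> - \<infinity>" using assms dens_pos_iff by (auto simp: Theta_def)
  then show ?thesis by (cases "\<psi> x") (auto simp: dens_def exp_ext_def)
qed

lemma Theta_log_concave:
  assumes T: "(\<psi>, r) \<in> Theta"
  shows "log_concave (dens \<psi>)"
  unfolding log_concave_def
proof (intro conjI allI ballI)
  fix x y t :: real assume t: "t \<in> {0<..<1}"
  let ?m = "(1 - t) * x + t * y"
  show "dens \<psi> x powr (1 - t) * dens \<psi> y powr t \<le> dens \<psi> ?m"
  proof (cases "0 < dens \<psi> x \<and> 0 < dens \<psi> y")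
    case True
    have "ereal (1 - t) * \<psi> x + ereal t * \<psi> y \<le> \<psi> ?m"
      using T t unfolding Theta_def concave_ext_def by blast
    then have le: "ereal ((1 - t) * ln (dens \<psi> x) + t * ln (dens \<psi> y)) \<le> \<psi> ?m"
      using Theta_eq_ln_dens[OF T] True by simp
    then have "\<psi> ?m \<noteq> - \<infinity>" by (metis MInfty_neq_ereal(1) ereal_infty_less_eq(2))
    then have pos: "0 < dens \<psi> ?m" using dens_pos_iff[OF T] by blast
    have "(1 - t) * ln (dens \<psi> x) + t * ln (dens \<psi> y) \<le> ln (dens \<psi> ?m)"
      using le Theta_eq_ln_dens[OF T pos] by simp
    then have "exp ((1 - t) * ln (dens \<psi> x) + t * ln (dens \<psi> y)) \<le> dens \<psi> ?m"
      using pos by (simp add: ln_ge_iff)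
    then show ?thesis using True by (simp add: powr_def exp_add)
  next
    case False
    then have "dens \<psi> x = 0 \<or> dens \<psi> y = 0" using dens_nonneg[of \<psi> x] dens_nonneg[of \<psi> y] by linarith
    then show ?thesis by auto
  qed
qed simp

lemma Theta_usc:
  assumes T: "(\<psi>, r) \<in> Theta" and e: "0 < e"
  shows "\<forall>\<^sub>F y in at x. dens \<psi> y < dens \<psi> x + e"
proof -
  define v where "v = ln (dens \<psi> x + e)"
  have p: "0 < dens \<psi> x + e" using e dens_nonneg[of \<psi> x] by linarith
  have "\<psi> x < ereal v"
  proof (cases "0 < dens \<psi> x")
    case True
    then show ?thesis using Theta_eq_ln_dens[OF T True] p e by (simp add: v_def)
  next
    case False
    then have "\<psi> x = - \<infinity>" using dens_pos_iff[OF T] by blast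
    then show ?thesis by simp
  qed
  moreover have "Limsup (at x) \<psi> \<le> \<psi> x" using T by (simp add: Theta_def upper_semicont_def)
  ultimately have "Limsup (at x) \<psi> < ereal v" by (rule le_less_trans[rotated])
  then have "\<forall>\<^sub>F y in at x. \<psi> y < ereal v" by (rule Limsup_lessD)
  then show ?thesis
  proof eventually_elim
    case (elim y)
    show ?case
    proof (cases "0 < dens \<psi> y")
      case True
      then have "ln (dens \<psi> y) < v" using elim Theta_eq_ln_dens[OF T True] by simp
      then show ?thesis using True p by (simp add: v_def)
    next
      case False
      then show ?thesis using p by linarith
    qed
  qed
qed

text \<open>Measurability comes from upper semicontinuity, which makes the strict sublevel sets
  open.\<close>

lemma Theta_measurable:
  assumes T: "(\<psi>, r) \<in> Theta"
  shows "dens \<psi> \<in> borel_measurable borel"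
proof (rule borel_measurable_iff_less[THEN iffD2], intro allI)
  fix m
  have "open {x. dens \<psi> x < m}"
    unfolding open_subopen[of "{x. dens \<psi> x < m}"]
  proof
    fix x assume "x \<in> {x. dens \<psi> x < m}"
    then have x: "dens \<psi> x < m" by simp
    have "\<forall>\<^sub>F y in at x. dens \<psi> y < m" using Theta_usc[OF T, of "m - dens \<psi> x" x] x by simp
    then have "\<forall>\<^sub>F y in nhds x. dens \<psi> y < m"
      using x unfolding eventually_at_filter by (auto elim!: eventually_mono)
    then show "\<exists>U. open U \<and> x \<in> U \<and> U \<subseteq> {x. dens \<psi> x < m}"
      unfolding eventually_nhds by blast
  qed
  then show "{w \<in> space borel. dens \<psi> w < m} \<in> sets borel" by auto
qed

lemma Theta_integrable:
  assumes T: "(\<psi>, r) \<in> Theta"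
  shows "integrable lborel (dens \<psi>)" and "(LBINT x. dens \<psi> x) + r = 1"
proof -
  have n: "(\<integral>\<^sup>+ x. ennreal (dens \<psi> x) \<partial>lborel) + ennreal r = 1" and r: "0 \<le> r"
    using T by (auto simp: Theta_def)
  have fin: "(\<integral>\<^sup>+ x. ennreal (dens \<psi> x) \<partial>lborel) < \<infinity>"
    using n by (metis ennreal_add_eq_top ennreal_one_neq_top infinity_ennreal_def top.not_eq_extremum)
  show i: "integrable lborel (dens \<psi>)"
    by (rule integrableI_nonneg) (use Theta_measurable[OF T] fin in auto)
  have "(\<integral>\<^sup>+ x. ennreal (dens \<psi> x) \<partial>lborel) = ennreal (LBINT x. dens \<psi> x)"
    by (rule nn_integral_eq_integral[OF i]) simp
  then have "ennreal ((LBINT x. dens \<psi> x) + r) = ennreal 1"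
    using n r by (simp add: ennreal_plus)
  then show "(LBINT x. dens \<psi> x) + r = 1"
    using r by (subst (asm) ennreal_inj) auto
qed

section \<open>Increments, tails and continuity of the distribution functions\<close>

lemma dist_fun_real: "dist_fun \<psi> r (ereal x) = (LBINT y:{..x}. dens \<psi> y)"
  by (simp add: dist_fun_def Pr_def atMost_def)

lemma dist_fun_MInf: "dist_fun \<psi> r (- \<infinity>) = 0"
  by (simp add: dist_fun_def Pr_def set_lebesgue_integral_def)

lemma dist_fun_PInf: "(\<psi>, r) \<in> Theta \<Longrightarrow> dist_fun \<psi> r \<infinity> = 1"
  using Theta_integrable(2)[of \<psi> r] by (simp add: dist_fun_def Pr_def set_lebesgue_integral_def)

lemma set_integral_Icc_eq_Ioo:
  fixes h :: "real \<Rightarrow> real"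
  assumes "integrable lborel h"
  shows "(LBINT t:{x..y}. h t) = (LBINT t:{x<..<y}. h t)" "(LBINT t:{x<..y}. h t) = (LBINT t:{x<..<y}. h t)"
proof -
  have ae: "AE t in lborel. t \<noteq> x \<and> t \<noteq> y" using AE_lborel_singleton[of x] AE_lborel_singleton[of y] by auto
  have [measurable]: "h \<in> borel_measurable lborel" using assms by auto
  show "(LBINT t:{x..y}. h t) = (LBINT t:{x<..<y}. h t)"
    unfolding set_lebesgue_integral_def
  proof (rule integral_cong_AE)
    show "AE t in lborel. indicator {x..y} t *\<^sub>R h t = indicator {x<..<y} t *\<^sub>R h t"
      using ae by eventually_elim (auto split: split_indicator)
  qed auto
  show "(LBINT t:{x<..y}. h t) = (LBINT t:{x<..<y}. h t)"
    unfolding set_lebesgue_integral_def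
  proof (rule integral_cong_AE)
    show "AE t in lborel. indicator {x<..y} t *\<^sub>R h t = indicator {x<..<y} t *\<^sub>R h t"
      using ae by eventually_elim (auto split: split_indicator)
  qed auto
qed

lemma dist_fun_diff:
  assumes T: "(\<psi>, r) \<in> Theta" and xy: "x \<le> y"
  shows "dist_fun \<psi> r (ereal y) - dist_fun \<psi> r (ereal x) = (LBINT t:{x<..<y}. dens \<psi> t)"
proof -
  note i = Theta_integrable(1)[OF T]
  have un: "{..y} = {..x} \<union> {x<..y}" using xy by auto
  have "(LBINT t:{..y}. dens \<psi> t) = (LBINT t:{..x}. dens \<psi> t) + (LBINT t:{x<..y}. dens \<psi> t)"
    unfolding un by (rule set_integral_Un) (auto intro: set_integrable_of_integrable[OF i])
  then show ?thesis by (simp add: dist_fun_real set_integral_Icc_eq_Ioo(2)[OF i])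
qed

text \<open>Reduces each claim about the mass at infinity to a value of the distribution function
  and a tail of the density.\<close>

lemma dist_fun_tail:
  assumes T: "(\<psi>, r) \<in> Theta"
  shows "r = 1 - dist_fun \<psi> r (ereal x) - (LBINT t:{x<..}. dens \<psi> t)"
proof -
  note i = Theta_integrable(1)[OF T]
  have un: "UNIV = {..x} \<union> {x<..}" by auto
  have "(LBINT t. dens \<psi> t) = (LBINT t:UNIV. dens \<psi> t)" by (simp add: set_lebesgue_integral_def)
  also have "\<dots> = (LBINT t:{..x}. dens \<psi> t) + (LBINT t:{x<..}. dens \<psi> t)"
    unfolding un by (rule set_integral_Un) (auto intro: set_integrable_of_integrable[OF i])
  finally show ?thesis using Theta_integrable(2)[OF T] by (simp add: dist_fun_real)
qed

lemma dist_fun_mono: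
  assumes T: "(\<psi>, r) \<in> Theta" and xy: "x \<le> y"
  shows "dist_fun \<psi> r (ereal x) \<le> dist_fun \<psi> r (ereal y)"
  unfolding dist_fun_real using xy
  by (intro set_integral_mono_subset Theta_integrable(1)[OF T]) auto

text \<open>Continuity at \<open>x\<close> from a local bound on the density: by upper
  semicontinuity it stays below \<open>dens \<psi> x + 1\<close> near \<open>x\<close>.\<close>

lemma dist_fun_near:
  assumes T: "(\<psi>, r) \<in> Theta" and e: "0 < e"
  shows "\<exists>h>0. \<forall>u v. x - h < u \<longrightarrow> u \<le> v \<longrightarrow> v < x + h \<longrightarrow>
    dist_fun \<psi> r (ereal v) - dist_fun \<psi> r (ereal u) \<le> e"
proof -
  define C where "C = dens \<psi> x + 1"
  have C: "0 < C" unfolding C_def by (rule add_nonneg_pos) auto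
  obtain s where s: "0 < s" "\<And>y. y \<noteq> x \<Longrightarrow> dist y x < s \<Longrightarrow> dens \<psi> y < C"
    using Theta_usc[OF T, of 1 x] by (auto simp: eventually_at C_def)
  define h where "h = min s (e / (2 * C))"
  have h: "0 < h" "h \<le> s" "C * (2 * h) \<le> e" using s C e by (auto simp: h_def min_def field_simps)
  have "dist_fun \<psi> r (ereal v) - dist_fun \<psi> r (ereal u) \<le> e"
    if uv: "x - h < u" "u \<le> v" "v < x + h" for u v
  proof -
    have le: "dens \<psi> t \<le> C" if "t \<in> {u..v}" for t
    proof (cases "t = x")
      case False
      moreover have "dist t x < s" using that uv h by (auto simp: dist_real_def abs_less_iff)
      ultimately show ?thesis using s(2) by (simp add: less_imp_le)
    qed (simp add: C_def)
    have "dist_fun \<psi> r (ereal v) - dist_fun \<psi> r (ereal u) = (LBINT t:{u..v}. dens \<psi> t)"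
      using dist_fun_diff[OF T uv(2)] set_integral_Icc_eq_Ioo(1)[OF Theta_integrable(1)[OF T]] by simp
    also have "\<dots> \<le> (LBINT t:{u..v}. C)"
      using le by (intro set_integral_mono set_integrable_of_integrable Theta_integrable(1)[OF T] borel_integrable_atLeastAtMost') auto
    also have "\<dots> = C * (v - u)" by (rule set_integral_const_Icc[OF uv(2)])
    also have "\<dots> \<le> C * (2 * h)" using C uv by (intro mult_left_mono) auto
    finally show ?thesis using h by simp
  qed
  then show ?thesis using h by blast
qed

text \<open>Monotone functions converging on a dense set converge wherever the limit is continuous.
  The rationals are used because the passage to probabilities has to enumerate the points.\<close>

lemma dist_fun_tendsto_from_rats:
  assumes T: "(\<phi>, q) \<in> Theta" and Tk: "\<And>k. (\<psi> k, r k) \<in> Theta"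
    and rat: "\<And>p. p \<in> \<rat> \<Longrightarrow> a < ereal p \<Longrightarrow> ereal p < b \<Longrightarrow>
      (\<lambda>k. dist_fun (\<psi> k) (r k) (ereal p)) \<longlonglongrightarrow> dist_fun \<phi> q (ereal p)"
    and x: "a < ereal x" "ereal x < b"
  shows "(\<lambda>k. dist_fun (\<psi> k) (r k) (ereal x)) \<longlonglongrightarrow> dist_fun \<phi> q (ereal x)"
  unfolding tendsto_iff dist_real_def
proof (intro allI impI)
  fix e :: real assume e: "0 < e"
  obtain h where h: "0 < h" "\<And>u v. x - h < u \<Longrightarrow> u \<le> v \<Longrightarrow> v < x + h \<Longrightarrow>
    dist_fun \<phi> q (ereal v) - dist_fun \<phi> q (ereal u) \<le> e / 2"
    using dist_fun_near[OF T, of "e / 2" x] e by auto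
  have "max a (ereal (x - h)) < ereal x" "ereal x < min b (ereal (x + h))" using x h by auto
  then obtain u' v' where u': "max a (ereal (x - h)) < ereal u'" "ereal u' < ereal x"
    and v': "ereal x < ereal v'" "ereal v' < min b (ereal (x + h))" using ereal_dense2 by meson
  obtain u where u: "u \<in> \<rat>" "u' < u" "u < x" using Rats_dense_in_real[of u' x] u' by auto
  obtain v where v: "v \<in> \<rat>" "x < v" "v < v'" using Rats_dense_in_real[of x v'] v' by auto
  have ab: "a < ereal u" "ereal u < b" "a < ereal v" "ereal v < b" and uv: "x - h < u" "v < x + h"
    using u v u' v' x ereal_less_between(1)[of a u' u] ereal_less_between(2)[of v' b v]
      ereal_less_between(1)[of a x v] ereal_less_between(2)[of x b u] by auto
  have d: "dist_fun \<phi> q (ereal x) - dist_fun \<phi> q (ereal u) \<le> e / 2"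
    "dist_fun \<phi> q (ereal v) - dist_fun \<phi> q (ereal x) \<le> e / 2"
    using h(2)[of u x] h(2)[of x v] u v uv h(1) by auto
  have "\<forall>\<^sub>F k in sequentially. dist (dist_fun (\<psi> k) (r k) (ereal u)) (dist_fun \<phi> q (ereal u)) < e / 2"
    using tendstoD[OF rat[OF u(1) ab(1,2)], of "e / 2"] e by simp
  moreover have "\<forall>\<^sub>F k in sequentially. dist (dist_fun (\<psi> k) (r k) (ereal v)) (dist_fun \<phi> q (ereal v)) < e / 2"
    using tendstoD[OF rat[OF v(1) ab(3,4)], of "e / 2"] e by simp
  ultimately show "\<forall>\<^sub>F k in sequentially. \<bar>dist_fun (\<psi> k) (r k) (ereal x) - dist_fun \<phi> q (ereal x)\<bar> < e"
  proof eventually_elim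
    case (elim k)
    have "dist_fun (\<psi> k) (r k) (ereal u) \<le> dist_fun (\<psi> k) (r k) (ereal x)"
      "dist_fun (\<psi> k) (r k) (ereal x) \<le> dist_fun (\<psi> k) (r k) (ereal v)"
      using u v by (auto intro: dist_fun_mono[OF Tk])
    then show ?case using elim d unfolding dist_real_def by linarith
  qed
qed

section \<open>Sequences of parameters\<close>

lemma eventually_at_left_ereal_between:
  fixes a b :: ereal
  assumes "a < b"
  shows "\<forall>\<^sub>F x in at_left b. a < x \<and> x < b" "at_left b \<noteq> bot"
proof -
  show "\<forall>\<^sub>F x in at_left b. a < x \<and> x < b"
    unfolding eventually_at_left[OF assms] using assms by blast
  have "\<not> (\<forall>\<^sub>F x in at_left b. False)"
    unfolding eventually_at_left[OF assms] using dense by blast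
  then show "at_left b \<noteq> bot" by (auto simp: trivial_limit_def)
qed

text \<open>The deterministic counterpart of the theorem: a convergent sequence of parameters takes
  the place of the estimators.\<close>

locale Theta_seq =
  fixes \<phi> :: "real \<Rightarrow> ereal" and q :: real and \<psi> :: "nat \<Rightarrow> real \<Rightarrow> ereal" and r :: "nat \<Rightarrow> real"
    and a b :: ereal
  assumes T: "(\<phi>, q) \<in> Theta" and Tk: "\<And>k. (\<psi> k, r k) \<in> Theta"
    and ab: "a < b" and mass: "dist_fun \<phi> q a < Lim (at_left b) (dist_fun \<phi> q)"
    and dist_conv: "\<And>x. a < ereal x \<Longrightarrow> ereal x < b \<Longrightarrow>
      (\<lambda>k. dist_fun (\<psi> k) (r k) (ereal x)) \<longlonglongrightarrow> dist_fun \<phi> q (ereal x)"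
begin

definition support :: "real set" where
  "support = {x. a < ereal x \<and> ereal x < b \<and> 0 < dens \<phi> x}"

lemma dist_fun_eq_left_end:
  assumes null: "\<And>t. a < ereal t \<Longrightarrow> ereal t < b \<Longrightarrow> t \<noteq> u \<Longrightarrow> dens \<phi> t = 0"
    and x: "a < ereal x" "ereal x < b"
  shows "dist_fun \<phi> q (ereal x) = dist_fun \<phi> q a"
proof -
  have zero: "(LBINT t:S. dens \<phi> t) = 0" if "\<And>t. t \<in> S \<Longrightarrow> a < ereal t \<and> t \<le> x" for S
    unfolding set_lebesgue_integral_def
  proof (rule integral_eq_zero_AE)
    show "AE t in lborel. indicator S t *\<^sub>R dens \<phi> t = 0"
      using AE_lborel_singleton[of u]
    proof eventually_elim
      case (elim t)
      show ?case
        using that[of t] null[of t] elim ereal_less_between(2)[OF x(2), of t]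
        by (auto split: split_indicator)
    qed
  qed
  show ?thesis
  proof (cases a)
    case (real y)
    then have "y \<le> x" using x by simp
    have "(LBINT t:{y<..<x}. dens \<phi> t) = 0" by (rule zero) (use real in auto)
    with dist_fun_diff[OF T \<open>y \<le> x\<close>] real show ?thesis by simp
  next
    case MInf
    have "(LBINT t:{..x}. dens \<phi> t) = 0" by (rule zero) (use MInf in auto)
    then show ?thesis using MInf by (simp add: dist_fun_real dist_fun_MInf)
  qed (use x in simp)
qed

text \<open>Otherwise the distribution function would equal its value at \<open>a\<close> on all of
  \<open>(a,b)\<close>, contrary to \<open>mass\<close>. Two points are needed for
  \<open>c < d\<close>.\<close>

lemma support_two_points:
  obtains u v where "u \<in> support" "v \<in> support" "u < v"
proof (rule ccontr)
  assume "\<not> thesis"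
  then have no: "\<not> (\<exists>u v. u \<in> support \<and> v \<in> support \<and> u < v)" using that by blast
  have "\<exists>u. \<forall>t. t \<in> support \<longrightarrow> t = u"
  proof (cases "support = {}")
    case False
    then obtain u where "u \<in> support" by blast
    then have "t = u" if "t \<in> support" for t
      using no that by (metis linorder_neqE_linordered_idom)
    then show ?thesis by blast
  qed auto
  then obtain u where u: "\<And>t. t \<in> support \<Longrightarrow> t = u" by blast
  have null: "dens \<phi> t = 0" if "a < ereal t" "ereal t < b" "t \<noteq> u" for t
  proof -
    have "\<not> 0 < dens \<phi> t" using u[of t] that by (auto simp: support_def)
    then show ?thesis using dens_nonneg[of \<phi> t] by linarith
  qed
  have "\<forall>\<^sub>F x in at_left b. dist_fun \<phi> q a = dist_fun \<phi> q x"
    using eventually_at_left_ereal_between(1)[OF ab]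
  proof eventually_elim
    case (elim x)
    then obtain x' where x': "x = ereal x'" by (cases x) auto
    have "dist_fun \<phi> q (ereal x') = dist_fun \<phi> q a"
      by (rule dist_fun_eq_left_end[OF null]) (use elim x' in auto)
    then show ?case using x' by simp
  qed
  then have "(dist_fun \<phi> q \<longlongrightarrow> dist_fun \<phi> q a) (at_left b)"
    by (rule Lim_transform_eventually[OF tendsto_const])
  then have "Lim (at_left b) (dist_fun \<phi> q) = dist_fun \<phi> q a"
    by (rule tendsto_Lim[OF eventually_at_left_ereal_between(2)[OF ab]])
  then show False using mass by simp
qed

definition c :: ereal where "c = Inf (ereal ` support)"

definition d :: ereal where "d = Sup (ereal ` support)"

sublocale log_concave_seq "\<lambda>k. dens (\<psi> k)" "dens \<phi>" a b c d
proof
  obtain u v where uv: "u \<in> support" "v \<in> support" "u < v" by (rule support_two_points)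
  show "c < d"
  proof -
    have "c \<le> ereal u" unfolding c_def using uv(1) by (intro Inf_lower) auto
    also have "\<dots> < ereal v" using uv by simp
    also have "\<dots> \<le> d" unfolding d_def using uv(2) by (intro Sup_upper) auto
    finally show ?thesis .
  qed
  show "a \<le> c" unfolding c_def by (rule Inf_greatest) (auto simp: support_def)
  show "d \<le> b" unfolding d_def by (rule Sup_least) (auto simp: support_def)
  show "0 < dens \<phi> x" if x: "c < ereal x" "ereal x < d" for x
  proof -
    obtain y where y: "y \<in> support" "y < x" using x(1) unfolding c_def Inf_less_iff by auto
    obtain z where z: "z \<in> support" "x < z" using x(2) unfolding d_def less_Sup_iff by auto
    have "min (dens \<phi> y) (dens \<phi> z) \<le> dens \<phi> x"
      using y z by (intro log_concave_min[OF Theta_log_concave[OF T]]) auto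
    then show ?thesis using y z by (auto simp: support_def)
  qed
  show "dens \<phi> x = 0" if "d < ereal x" "ereal x < b" for x
  proof (rule ccontr)
    assume "dens \<phi> x \<noteq> 0"
    then have "0 < dens \<phi> x" using dens_nonneg[of \<phi> x] by linarith
    moreover have "a < ereal x" using \<open>a \<le> c\<close> \<open>c < d\<close> that by (meson le_less_trans less_trans)
    ultimately have "ereal x \<le> d" using that unfolding d_def by (intro Sup_upper) (auto simp: support_def)
    then show False using that by simp
  qed
  show "dens \<phi> x = 0" if "a < ereal x" "ereal x < c" for x
  proof (rule ccontr)
    assume "dens \<phi> x \<noteq> 0"
    then have "0 < dens \<phi> x" using dens_nonneg[of \<phi> x] by linarith
    moreover have "ereal x < b" using \<open>d \<le> b\<close> \<open>c < d\<close> that by (meson less_le_trans less_trans)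
    ultimately have "c \<le> ereal x" using that unfolding c_def by (intro Inf_lower) (auto simp: support_def)
    then show False using that by simp
  qed
  show "(\<lambda>k. LBINT t:{x..y}. dens (\<psi> k) t) \<longlonglongrightarrow> (LBINT t:{x..y}. dens \<phi> t)"
    if xy: "a < ereal x" "x < y" "ereal y < b" for x y
  proof -
    have eq: "(LBINT t:{x..y}. dens \<theta> t) = dist_fun \<theta> s (ereal y) - dist_fun \<theta> s (ereal x)"
      if "(\<theta>, s) \<in> Theta" for \<theta> s
      using dist_fun_diff[OF that less_imp_le[OF xy(2)]]
        set_integral_Icc_eq_Ioo(1)[OF Theta_integrable(1)[OF that]] by simp
    have "ereal x < b" "a < ereal y" 
      using ereal_less_between(2)[OF xy(3), of x] ereal_less_between(1)[OF xy(1), of y] xy(2) by auto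
    then show ?thesis
      unfolding eq[OF T] eq[OF Tk] using xy by (intro tendsto_diff dist_conv)
  qed
qed (use Theta_log_concave[OF T] Theta_log_concave[OF Tk] Theta_integrable(1)[OF T]
    Theta_integrable(1)[OF Tk] Theta_usc[OF T] in auto)

lemma middle_point:
  obtains x where "a < ereal x" "ereal x < b"
  using ereal_dense2[OF ab] by blast

lemma abs_integral_diff_le_L1:
  assumes S: "S \<subseteq> einterval a b" "S \<in> sets borel"
  shows "\<bar>(LBINT x:S. dens (\<psi> k) x) - (LBINT x:S. dens \<phi> x)\<bar>
    \<le> (LBINT x:einterval a b. \<bar>dens (\<psi> k) x - dens \<phi> x\<bar>)"
proof -
  have "(LBINT x:S. dens (\<psi> k) x) - (LBINT x:S. dens \<phi> x) = (LBINT x:S. dens (\<psi> k) x - dens \<phi> x)"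
    by (rule set_integral_diff(2)[symmetric]) (use g_set_integrable f_set_integrable S in auto)
  also have "\<bar>\<dots>\<bar> \<le> (LBINT x:S. \<bar>dens (\<psi> k) x - dens \<phi> x\<bar>)"
    unfolding set_lebesgue_integral_def
    by (rule order_trans[OF integral_abs_bound]) (simp add: abs_mult)
  also have "\<dots> \<le> (LBINT x:einterval a b. \<bar>dens (\<psi> k) x - dens \<phi> x\<bar>)"
    using S gint fint by (intro set_integral_mono_subset) auto
  finally show ?thesis .
qed

lemma eventually_interval_L1:
  assumes "0 < \<eta>"
  shows "\<forall>\<^sub>F k in sequentially. \<bar>LBINT x=a..b. \<bar>dens (\<psi> k) x - dens \<phi> x\<bar>\<bar> \<le> \<eta>"
  using eventually_L1[OF assms]
proof eventually_elim
  case (elim k)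
  have "0 \<le> (LBINT x:einterval a b. \<bar>dens (\<psi> k) x - dens \<phi> x\<bar>)"
    unfolding set_lebesgue_integral_def by (rule integral_nonneg_AE) auto
  then show ?case using elim less_imp_le[OF ab] by (simp add: interval_lebesgue_integral_def)
qed

text \<open>From a fixed \<open>x0\<close>, each real \<open>x\<close> in the closed interval is
  reached by an integral over a subset of \<open>(a,b)\<close>, so convergence in mean controls all
  increments at once. At the infinite arguments the two functions agree.\<close>

lemma eventually_dist_fun:
  assumes \<eta>: "0 < \<eta>"
  shows "\<forall>\<^sub>F k in sequentially. \<forall>x\<in>{a..b}. \<bar>dist_fun (\<psi> k) (r k) x - dist_fun \<phi> q x\<bar> \<le> \<eta>"
proof -
  obtain x0 where x0: "a < ereal x0" "ereal x0 < b" by (rule middle_point)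
  have "\<forall>\<^sub>F k in sequentially. \<bar>dist_fun (\<psi> k) (r k) (ereal x0) - dist_fun \<phi> q (ereal x0)\<bar> < \<eta> / 2"
    using tendstoD[OF dist_conv[OF x0], of "\<eta> / 2"] \<eta> by (simp add: dist_real_def)
  moreover have "\<forall>\<^sub>F k in sequentially. (LBINT x:einterval a b. \<bar>dens (\<psi> k) x - dens \<phi> x\<bar>) \<le> \<eta> / 2"
    by (rule eventually_L1) (use \<eta> in simp)
  ultimately show ?thesis
  proof eventually_elim
    case (elim k)
    show ?case
    proof
      fix x assume x: "x \<in> {a..b}"
      show "\<bar>dist_fun (\<psi> k) (r k) x - dist_fun \<phi> q x\<bar> \<le> \<eta>"
      proof (cases x)
        case PInf
        then show ?thesis using \<eta> by (simp add: dist_fun_PInf[OF T] dist_fun_PInf[OF Tk])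
      next
        case MInf
        then show ?thesis using \<eta> by (simp add: dist_fun_MInf)
      next
        case (real y)
        have y: "a \<le> ereal y" "ereal y \<le> b" using x real by auto
        show ?thesis
        proof (cases "x0 \<le> y")
          case True
          have "{x0<..<y} \<subseteq> einterval a b"
            using ereal_less_between(1)[OF x0(1)] y(2) by (auto simp: einterval_def intro: less_le_trans[of _ "ereal y"])
          from order_trans[OF abs_integral_diff_le_L1[OF this] elim(2)]
          have I: "\<bar>(LBINT x:{x0<..<y}. dens (\<psi> k) x) - (LBINT x:{x0<..<y}. dens \<phi> x)\<bar> \<le> \<eta> / 2" by simp
          have aux: "\<bar>A - B\<bar> \<le> \<eta> / 2 \<Longrightarrow> \<bar>C - D\<bar> < \<eta> / 2 \<Longrightarrow> E - C = A \<Longrightarrow> G - D = B \<Longrightarrow> \<bar>E - G\<bar> \<le> \<eta>"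
            for A B C D E G :: real by linarith
          show ?thesis
            unfolding real by (rule aux[OF I elim(1) dist_fun_diff[OF Tk True] dist_fun_diff[OF T True]])
        next
          case False
          then have le: "y \<le> x0" by simp
          have "{y<..<x0} \<subseteq> einterval a b"
            using ereal_less_between(2)[OF x0(2)] y(1) by (auto simp: einterval_def intro: le_less_trans[of _ "ereal y"])
          from order_trans[OF abs_integral_diff_le_L1[OF this] elim(2)]
          have I: "\<bar>(LBINT x:{y<..<x0}. dens (\<psi> k) x) - (LBINT x:{y<..<x0}. dens \<phi> x)\<bar> \<le> \<eta> / 2" by simp
          have aux: "\<bar>A - B\<bar> \<le> \<eta> / 2 \<Longrightarrow> \<bar>C - D\<bar> < \<eta> / 2 \<Longrightarrow> C - E = A \<Longrightarrow> D - G = B \<Longrightarrow> \<bar>E - G\<bar> \<le> \<eta>"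
            for A B C D E G :: real by linarith
          show ?thesis
            unfolding real by (rule aux[OF I elim(1) dist_fun_diff[OF Tk le] dist_fun_diff[OF T le]])
        qed
      qed
    qed
  qed
qed

section \<open>The mass at infinity\<close>

lemma eventually_q_infinite:
  assumes b: "b = \<infinity>" and \<eta>: "0 < \<eta>"
  shows "\<forall>\<^sub>F k in sequentially. \<bar>r k - q\<bar> \<le> \<eta>"
proof -
  obtain x0 where x0: "a < ereal x0" "ereal x0 < b" by (rule middle_point)
  have "\<forall>\<^sub>F k in sequentially. \<bar>dist_fun (\<psi> k) (r k) (ereal x0) - dist_fun \<phi> q (ereal x0)\<bar> < \<eta> / 2"
    using tendstoD[OF dist_conv[OF x0], of "\<eta> / 2"] \<eta> by (simp add: dist_real_def)
  moreover have "\<forall>\<^sub>F k in sequentially. (LBINT x:einterval a b. \<bar>dens (\<psi> k) x - dens \<phi> x\<bar>) \<le> \<eta> / 2"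
    by (rule eventually_L1) (use \<eta> in simp)
  ultimately show ?thesis
  proof eventually_elim
    case (elim k)
    have "{x0<..} \<subseteq> einterval a b"
      using ereal_less_between(1)[OF x0(1)] b by (auto simp: einterval_def)
    from order_trans[OF abs_integral_diff_le_L1[OF this] elim(2)]
    have I: "\<bar>(LBINT x:{x0<..}. dens (\<psi> k) x) - (LBINT x:{x0<..}. dens \<phi> x)\<bar> \<le> \<eta> / 2" by simp
    have aux: "\<bar>A - B\<bar> \<le> \<eta> / 2 \<Longrightarrow> \<bar>C - D\<bar> < \<eta> / 2 \<Longrightarrow> E = 1 - C - A \<Longrightarrow> G = 1 - D - B \<Longrightarrow> \<bar>E - G\<bar> \<le> \<eta>"
      for A B C D E G :: real by linarith
    show ?case by (rule aux[OF I elim(1) dist_fun_tail[OF Tk] dist_fun_tail[OF T]])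
  qed
qed

text \<open>Mass of the density beyond \<beta> can only lower \<open>r k\<close>.\<close>

lemma eventually_q_le:
  assumes b: "b = ereal \<beta>" and \<eta>: "0 < \<eta>"
  shows "\<forall>\<^sub>F k in sequentially. r k \<le> 1 - dist_fun \<phi> q b + \<eta>"
  using eventually_dist_fun[OF \<eta>]
proof eventually_elim
  case (elim k)
  have "\<bar>dist_fun (\<psi> k) (r k) b - dist_fun \<phi> q b\<bar> \<le> \<eta>" using elim ab by auto
  moreover have "0 \<le> (LBINT t:{\<beta><..}. dens (\<psi> k) t)"
    unfolding set_lebesgue_integral_def by (rule integral_nonneg_AE) auto
  ultimately show ?case using dist_fun_tail[OF Tk, of k \<beta>] unfolding b by linarith
qed

text \<open>The cut \<open>t\<close> lies to the left of \<open>b\<close>, inside the reach of the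
  tail estimates; the tail from \<beta> on is no larger.\<close>

lemma eventually_q_ge_if_tail:
  assumes b: "b = ereal \<beta>" and \<eta>: "0 < \<eta>" and t: "ereal t < d"
    and tail: "\<forall>\<^sub>F k in sequentially. (LBINT y:{t<..}. dens (\<psi> k) y) \<le> K + \<eta> / 2"
  shows "\<forall>\<^sub>F k in sequentially. 1 - dist_fun \<phi> q b - K - \<eta> \<le> r k"
proof -
  have "\<forall>\<^sub>F k in sequentially. \<forall>x\<in>{a..b}. \<bar>dist_fun (\<psi> k) (r k) x - dist_fun \<phi> q x\<bar> \<le> \<eta> / 2"
    by (rule eventually_dist_fun) (use \<eta> in simp)
  with tail show ?thesis
  proof eventually_elim
    case (elim k)
    have "\<bar>dist_fun (\<psi> k) (r k) b - dist_fun \<phi> q b\<bar> \<le> \<eta> / 2" using elim ab by auto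
    moreover have "t \<le> \<beta>" using less_le_trans[OF t db] b by simp
    then have "(LBINT y:{\<beta><..}. dens (\<psi> k) y) \<le> K + \<eta> / 2"
      using tail_mono[of t \<beta> k] elim by simp
    ultimately show ?case using dist_fun_tail[OF Tk, of k \<beta>] unfolding b by linarith
  qed
qed

text \<open>A zero of the density at \<open>b\<close> rules out a jump at \<open>d = b\<close>, so
  the tails become small and the upper bound is attained.\<close>

lemma eventually_q_eq:
  assumes b: "b = ereal \<beta>" and f0: "dens \<phi> \<beta> = 0" and \<eta>: "0 < \<eta>"
  shows "\<forall>\<^sub>F k in sequentially. \<bar>r k - (1 - dist_fun \<phi> q b)\<bar> \<le> \<eta>"
proof -
  have "vanishing_right \<or> d < b"
    using vanishing_right_if_zero[of \<beta>] f0 b db by (cases "d = b") auto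
  then obtain t where t: "ereal t < d" "\<forall>\<^sub>F k in sequentially. (LBINT y:{t<..}. dens (\<psi> k) y) \<le> \<eta> / 2"
    using eventually_tail_small[of "\<eta> / 2"] \<eta> by auto
  have "\<forall>\<^sub>F k in sequentially. 1 - dist_fun \<phi> q b - 0 - \<eta> \<le> r k"
    by (rule eventually_q_ge_if_tail[OF b \<eta> t(1)]) (use t(2) in simp)
  with eventually_q_le[OF b \<eta>] show ?thesis
    by eventually_elim (simp add: abs_le_iff)
qed

text \<open>The difference quotients at \<open>\<beta>\<close> decrease, so their limit is their infimum; if it is negative,
  some chord has negative slope and the chord bound on the tail applies.\<close>

lemma eventually_q_ge:
  assumes b: "b = ereal \<beta>" and fb: "0 < dens \<phi> \<beta>" and D: "left_deriv \<phi> \<beta> < 0" and \<eta>: "0 < \<eta>"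
  shows "\<forall>\<^sub>F k in sequentially.
    1 - dist_fun \<phi> q b - real_of_ereal (ereal (dens \<phi> \<beta>) / \<bar>left_deriv \<phi> \<beta>\<bar>) - \<eta> \<le> r k"
proof -
  let ?f = "dens \<phi>"
  have "\<not> d < b" using f_zero_beyond[of \<beta>] fb b by auto
  then have d\<beta>: "d = ereal \<beta>" using db b by (simp add: order_le_less)
  obtain u where u: "c < ereal u" "ereal u < d" using ereal_dense2[OF cd] by blast
  have u\<beta>: "u < \<beta>" using u d\<beta> by simp
  have pos: "0 < ?f x" if "u \<le> x" "x < \<beta>" for x
    using that d\<beta> ereal_less_between(1)[OF u(1), of x] by (intro fpos) auto
  define sl where "sl = (\<lambda>x. (ln (?f \<beta>) - ln (?f x)) / (\<beta> - x))"
  have sl: "(\<phi> \<beta> - \<phi> x) / ereal (\<beta> - x) = ereal (sl x)" if "u \<le> x" "x < \<beta>" for x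
    using Theta_eq_ln_dens[OF T fb] Theta_eq_ln_dens[OF T pos[OF that]] that by (simp add: sl_def)
  have anti: "sl y \<le> sl x" if xy: "u \<le> x" "x \<le> y" "y < \<beta>" for x y
  proof (cases "x = y")
    case False
    then have xy': "x < y" using xy by simp
    have px: "0 < ?f x" and py: "0 < ?f y" using pos xy by auto
    have "?f x powr ((\<beta> - y) / (\<beta> - x)) * ?f \<beta> powr ((y - x) / (\<beta> - x)) \<le> ?f y"
      by (rule log_concave_between[OF lcf xy' xy(3)])
    moreover have "0 < ?f x powr ((\<beta> - y) / (\<beta> - x)) * ?f \<beta> powr ((y - x) / (\<beta> - x))"
      using px fb by simp
    ultimately have "ln (?f x powr ((\<beta> - y) / (\<beta> - x)) * ?f \<beta> powr ((y - x) / (\<beta> - x))) \<le> ln (?f y)"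
      using py by simp
    then have "(\<beta> - y) / (\<beta> - x) * ln (?f x) + (y - x) / (\<beta> - x) * ln (?f \<beta>) \<le> ln (?f y)"
      using px fb by (simp add: ln_mult ln_powr)
    moreover have "(y - x) / (\<beta> - x) = 1 - (\<beta> - y) / (\<beta> - x)" using xy xy' by (simp add: field_simps)
    ultimately have "ln (?f \<beta>) - ln (?f y) \<le> (\<beta> - y) / (\<beta> - x) * (ln (?f \<beta>) - ln (?f x))"
      by (simp add: algebra_simps)
    then have "ln (?f \<beta>) - ln (?f y) \<le> sl x * (\<beta> - y)" by (simp add: sl_def mult.commute)
    then show ?thesis using xy by (simp add: sl_def pos_divide_le_eq)
  qed simp
  \<comment> \<open>\<open>left_deriv\<close> is defined through \<open>Lim\<close>, so a limit has
    to be exhibited before anything can be said about it; the infimum of the decreasing quotients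
    supplies it.\<close>
  define L where "L = (INF x\<in>{u..<\<beta>}. ereal (sl x))"
  have ev: "\<forall>\<^sub>F x in at_left \<beta>. u \<le> x \<and> x < \<beta>"
    by (rule eventually_at_leftI[OF _ u\<beta>]) auto
  have "((\<lambda>x. (\<phi> \<beta> - \<phi> x) / ereal (\<beta> - x)) \<longlongrightarrow> L) (at_left \<beta>)"
  proof (rule order_tendstoI)
    fix m assume m: "m < L"
    show "\<forall>\<^sub>F x in at_left \<beta>. m < (\<phi> \<beta> - \<phi> x) / ereal (\<beta> - x)"
      using ev
    proof eventually_elim
      case (elim x)
      then have "L \<le> ereal (sl x)" unfolding L_def by (intro INF_lower) auto
      then show ?case using m elim sl[of x] by simp
    qed
  next
    fix m assume "L < m"
    then obtain x1 where x1: "u \<le> x1" "x1 < \<beta>" "ereal (sl x1) < m"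
      unfolding L_def INF_less_iff by auto
    have "\<forall>\<^sub>F x in at_left \<beta>. x1 \<le> x \<and> x < \<beta>"
      by (rule eventually_at_leftI[OF _ x1(2)]) auto
    then show "\<forall>\<^sub>F x in at_left \<beta>. (\<phi> \<beta> - \<phi> x) / ereal (\<beta> - x) < m"
    proof eventually_elim
      case (elim x)
      then have "ereal (sl x) \<le> ereal (sl x1)" using anti[of x1 x] x1 by simp
      then have "ereal (sl x) < m" using x1(3) by (rule le_less_trans)
      then show ?case using x1(1) elim sl[of x] by simp
    qed
  qed
  then have lim: "((\<lambda>x. (\<phi> \<beta> - \<phi> x) / ereal (\<beta> - x)) \<longlongrightarrow> left_deriv \<phi> \<beta>) (at_left \<beta>)"
    using tendsto_Lim[OF trivial_limit_at_left_real] unfolding left_deriv_def by metis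
  have lim: "((\<lambda>x. ereal (sl x)) \<longlongrightarrow> left_deriv \<phi> \<beta>) (at_left \<beta>)"
    by (rule Lim_transform_eventually[OF lim]) (use ev sl in \<open>auto elim!: eventually_mono\<close>)
  define K where "K = real_of_ereal (ereal (?f \<beta>) / \<bar>left_deriv \<phi> \<beta>\<bar>)"
  have "\<forall>\<^sub>F x in at_left \<beta>. sl x < 0 \<and> ?f \<beta> / - sl x < K + \<eta> / 4"
  proof (cases "left_deriv \<phi> \<beta>")
    case (real D')
    then have lim': "(sl \<longlongrightarrow> D') (at_left \<beta>)" and D': "D' < 0" using lim D by auto
    have "((\<lambda>x. ?f \<beta> / - sl x) \<longlongrightarrow> ?f \<beta> / - D') (at_left \<beta>)"
      using D' by (intro tendsto_intros lim') auto
    moreover have "K = ?f \<beta> / - D'" using D' real by (simp add: K_def)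
    ultimately have "\<forall>\<^sub>F x in at_left \<beta>. ?f \<beta> / - sl x < K + \<eta> / 4"
      using \<eta> by (intro order_tendstoD(2)) auto
    with order_tendstoD(2)[OF lim' D'] show ?thesis by eventually_elim auto
  next
    case MInf
    \<comment> \<open>Division by \<infinity> gives 0 in \<open>ereal\<close>, matching the
      convention for an infinite slope.\<close>
    then have K: "K = 0" by (simp add: K_def)
    \<comment> \<open>A slope below this threshold brings \<open>?f \<beta> / - sl x\<close> under a
      quarter of \<eta>.\<close>
    have "\<forall>\<^sub>F x in at_left \<beta>. ereal (sl x) < ereal (- (?f \<beta> * 4 / \<eta>))"
      by (rule order_tendstoD(2)[OF lim]) (use MInf in simp)
    then show ?thesis
    proof eventually_elim
      case (elim x)
      then have l: "?f \<beta> * 4 / \<eta> < - sl x" by simp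
      have p: "0 < ?f \<beta> * 4 / \<eta>" using fb \<eta> by simp
      then have n: "0 < - sl x" using l by linarith
      have "?f \<beta> * 4 < - sl x * \<eta>" using l \<eta> by (simp add: pos_divide_less_eq)
      then have "?f \<beta> / - sl x < \<eta> / 4" using n by (simp add: field_simps)
      then show ?case using n K by simp
    qed
  qed (use D in simp)
  with ev have "\<forall>\<^sub>F x in at_left \<beta>. (u \<le> x \<and> x < \<beta>) \<and> sl x < 0 \<and> ?f \<beta> / - sl x < K + \<eta> / 4"
    by eventually_elim auto
  then obtain x0 where x0: "u \<le> x0" "x0 < \<beta>" "sl x0 < 0" "?f \<beta> / - sl x0 < K + \<eta> / 4"
    using eventually_happens'[OF trivial_limit_at_left_real] by blast
  have p0: "0 < ?f x0" by (rule pos[OF x0(1,2)])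
  have "ln (?f \<beta>) < ln (?f x0)" using x0 by (simp add: sl_def divide_less_0_iff)
  then have dec: "?f \<beta> < ?f x0" using fb p0 by simp
  have val: "?f \<beta> * (\<beta> - x0) / ln (?f x0 / ?f \<beta>) = ?f \<beta> / - sl x0"
  proof -
    have "- sl x0 = ln (?f x0 / ?f \<beta>) / (\<beta> - x0)"
      using p0 fb by (simp add: sl_def ln_div minus_divide_left del: divide_minus_left)
    then show ?thesis by simp
  qed
  have cx0: "c < ereal x0" by (rule ereal_less_between(1)[OF u(1) x0(1)])
  obtain t where t: "t < \<beta>"
    "\<forall>\<^sub>F k in sequentially. (LBINT y:{t<..}. dens (\<psi> k) y) \<le> ?f \<beta> / - sl x0 + \<eta> / 4"
    using eventually_tail_slope[OF d\<beta> fb cx0 x0(2) dec, of "\<eta> / 4"] \<eta> unfolding val by auto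
  have "\<forall>\<^sub>F k in sequentially. (LBINT y:{t<..}. dens (\<psi> k) y) \<le> K + \<eta> / 2"
    using t(2) by eventually_elim (use x0(4) in linarith)
  then show ?thesis
    unfolding K_def[symmetric] using t(1) d\<beta> by (intro eventually_q_ge_if_tail[OF b \<eta>]) auto
qed

end

section \<open>Transfer to convergence in probability\<close>

text \<open>The exceptional events need not be measurable; each is replaced by a measurable cover
  with the same outer measure.\<close>

lemma outer_measure_of_Un_le:
  assumes A: "A \<subseteq> space M" and B: "B \<subseteq> space M"
  shows "outer_measure_of M (A \<union> B) \<le> outer_measure_of M A + outer_measure_of M B"
proof -
  obtain A' where A': "A' \<in> sets M" "A \<subseteq> A'" "outer_measure_of M A = emeasure M A'"
    using outer_measure_of_attain[OF A] by blast
  obtain B' where B': "B' \<in> sets M" "B \<subseteq> B'" "outer_measure_of M B = emeasure M B'"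
    using outer_measure_of_attain[OF B] by blast
  have "outer_measure_of M (A \<union> B) \<le> outer_measure_of M (A' \<union> B')"
    using A' B' by (intro outer_measure_of_mono) auto
  also have "\<dots> = emeasure M (A' \<union> B')" using A' B' by simp
  also have "\<dots> \<le> emeasure M A' + emeasure M B'" using A' B' by (intro emeasure_subadditive)
  finally show ?thesis using A' B' by simp
qed

lemma outer_measure_of_UN_tendsto_0:
  assumes "finite I" and sub: "\<And>i n. i \<in> I \<Longrightarrow> A i n \<subseteq> space M"
    and lim: "\<And>i. i \<in> I \<Longrightarrow> (\<lambda>n. outer_measure_of M (A i n)) \<longlonglongrightarrow> 0"
  shows "(\<lambda>n. outer_measure_of M (\<Union>i\<in>I. A i n)) \<longlonglongrightarrow> 0"
  using assms
proof (induction I)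
  case (insert i I)
  have "(\<lambda>n. outer_measure_of M (A i n) + outer_measure_of M (\<Union>i\<in>I. A i n)) \<longlonglongrightarrow> 0 + 0"
    using insert by (intro tendsto_add) auto
  then have lim: "(\<lambda>n. outer_measure_of M (A i n) + outer_measure_of M (\<Union>i\<in>I. A i n)) \<longlonglongrightarrow> 0" by simp
  have le: "outer_measure_of M (\<Union>i\<in>insert i I. A i n)
      \<le> outer_measure_of M (A i n) + outer_measure_of M (\<Union>i\<in>I. A i n)" for n
    unfolding UN_insert using insert.prems(1) by (intro outer_measure_of_Un_le) blast+
  show ?case
  proof (rule tendsto_sandwich[OF _ _ tendsto_const lim]; intro always_eventually allI)
    show "outer_measure_of M (\<Union>i\<in>insert i I. A i n)
        \<le> outer_measure_of M (A i n) + outer_measure_of M (\<Union>i\<in>I. A i n)" for n by (rule le)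
  qed simp
qed simp

text \<open>A statement about all sequences of parameters whose distribution functions converge is, by
  contradiction, a statement about closeness at finitely many rational points, and closeness there
  has probability tending to 1.\<close>

lemma to_prob_zero_if_sequential:
  fixes V :: "(real \<Rightarrow> ereal) \<Rightarrow> real \<Rightarrow> ennreal"
  assumes T: "(\<phi>, q) \<in> Theta"
    and est: "\<And>n \<omega>. \<omega> \<in> space M \<Longrightarrow> (\<phi>h n \<omega>, qh n \<omega>) \<in> Theta"
    and conv: "\<And>x. a < ereal x \<Longrightarrow> ereal x < b \<Longrightarrow>
      to_prob M (\<lambda>n \<omega>. dist_fun (\<phi>h n \<omega>) (qh n \<omega>) (ereal x)) (dist_fun \<phi> q (ereal x))"
    and seq: "\<And>\<psi> r \<eta>. (\<And>k. (\<psi> k, r k) \<in> Theta) \<Longrightarrow>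
      (\<And>x. a < ereal x \<Longrightarrow> ereal x < b \<Longrightarrow>
        (\<lambda>k. dist_fun (\<psi> k) (r k) (ereal x)) \<longlonglongrightarrow> dist_fun \<phi> q (ereal x)) \<Longrightarrow>
      0 < \<eta> \<Longrightarrow> \<forall>\<^sub>F k in sequentially. V (\<psi> k) (r k) \<le> ennreal \<eta>"
  shows "to_prob_zero M (\<lambda>n \<omega>. V (\<phi>h n \<omega>) (qh n \<omega>))"
  unfolding to_prob_zero_def
proof (intro allI impI)
  fix \<epsilon> :: ennreal assume \<epsilon>: "0 < \<epsilon>"
  obtain \<eta> where \<eta>: "0 < \<eta>" "ennreal \<eta> \<le> \<epsilon>"
  proof (cases \<epsilon>)
    case (real s)
    then show ?thesis using that[of s] \<epsilon> by auto
  next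
    case top
    then show ?thesis using that[of 1] by auto
  qed
  \<comment> \<open>The single index \<open>N\<close> governs both the number of rationals in the
    list and the tolerance. Each rational in \<open>(a,b)\<close> belongs to \<open>R k\<close> for
    all large \<open>k\<close>, so counterexamples taken for every \<open>N\<close> form a sequence
    converging at all of them.\<close>
  define R where "R N = {p \<in> from_nat_into \<rat> ` {..N}. a < ereal p \<and> ereal p < b}" for N
  define close where "close N \<psi> r \<longleftrightarrow>
    (\<forall>p\<in>R N. \<bar>dist_fun \<psi> r (ereal p) - dist_fun \<phi> q (ereal p)\<bar> \<le> 1 / real (Suc N))" for N \<psi> r
  have "\<exists>N. \<forall>\<psi> r. (\<psi>, r) \<in> Theta \<longrightarrow> close N \<psi> r \<longrightarrow> V \<psi> r \<le> ennreal \<eta>"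
  proof (rule ccontr)
    assume "\<not> ?thesis"
    then have "\<forall>N. \<exists>\<psi> r. (\<psi>, r) \<in> Theta \<and> close N \<psi> r \<and> \<not> V \<psi> r \<le> ennreal \<eta>" by blast
    then obtain \<psi> r where \<psi>: "\<And>N. (\<psi> N, r N) \<in> Theta" "\<And>N. close N (\<psi> N) (r N)"
      "\<And>N. \<not> V (\<psi> N) (r N) \<le> ennreal \<eta>" by metis
    have rat: "(\<lambda>k. dist_fun (\<psi> k) (r k) (ereal p)) \<longlonglongrightarrow> dist_fun \<phi> q (ereal p)"
      if p: "p \<in> \<rat>" "a < ereal p" "ereal p < b" for p
    proof -
      obtain i where i: "p = from_nat_into \<rat> i"
        using from_nat_into_surj[OF countable_rat p(1)] by metis
      have "\<forall>\<^sub>F k in sequentially. norm (dist_fun (\<psi> k) (r k) (ereal p) - dist_fun \<phi> q (ereal p)) \<le> 1 / real (Suc k)"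
        using eventually_ge_at_top[of i]
      proof eventually_elim
        case (elim k)
        then have "p \<in> R k" using p i by (auto simp: R_def)
        then show ?case using \<psi>(2)[of k] by (auto simp: close_def)
      qed
      moreover have "(\<lambda>k. 1 / real (Suc k)) \<longlonglongrightarrow> 0"
        using LIMSEQ_inverse_real_of_nat by (simp add: inverse_eq_divide)
      ultimately have "(\<lambda>k. dist_fun (\<psi> k) (r k) (ereal p) - dist_fun \<phi> q (ereal p)) \<longlonglongrightarrow> 0"
        by (rule Lim_null_comparison)
      then show ?thesis by (simp add: LIM_zero_iff)
    qed
    have "(\<lambda>k. dist_fun (\<psi> k) (r k) (ereal x)) \<longlonglongrightarrow> dist_fun \<phi> q (ereal x)"
      if "a < ereal x" "ereal x < b" for x
      by (rule dist_fun_tendsto_from_rats[OF T \<psi>(1) rat that])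
    then have "\<forall>\<^sub>F k in sequentially. V (\<psi> k) (r k) \<le> ennreal \<eta>"
      by (rule seq[OF \<psi>(1) _ \<eta>(1)])
    then show False using \<psi>(3) by simp
  qed
  then obtain N where N: "\<And>\<psi> r. (\<psi>, r) \<in> Theta \<Longrightarrow> close N \<psi> r \<Longrightarrow> V \<psi> r \<le> ennreal \<eta>" by blast
  define A where "A p n = {\<omega> \<in> space M. ennreal \<bar>dist_fun (\<phi>h n \<omega>) (qh n \<omega>) (ereal p) - dist_fun \<phi> q (ereal p)\<bar>
    > ennreal (1 / real (Suc N))}" for p n
  have lim: "(\<lambda>n. outer_measure_of M (\<Union>p\<in>R N. A p n)) \<longlonglongrightarrow> 0"
  proof (rule outer_measure_of_UN_tendsto_0)
    show "finite (R N)" by (simp add: R_def)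
    show "A p n \<subseteq> space M" for p n by (auto simp: A_def)
    show "(\<lambda>n. outer_measure_of M (A p n)) \<longlonglongrightarrow> 0" if "p \<in> R N" for p
      using conv[of p] that unfolding to_prob_def to_prob_zero_def A_def R_def by auto
  qed
  have "{\<omega> \<in> space M. \<epsilon> < V (\<phi>h n \<omega>) (qh n \<omega>)} \<subseteq> (\<Union>p\<in>R N. A p n)" for n
  proof
    fix \<omega> assume \<omega>: "\<omega> \<in> {\<omega> \<in> space M. \<epsilon> < V (\<phi>h n \<omega>) (qh n \<omega>)}"
    then have "\<not> V (\<phi>h n \<omega>) (qh n \<omega>) \<le> ennreal \<eta>" using \<eta> by auto
    then have "\<not> close N (\<phi>h n \<omega>) (qh n \<omega>)" using N est \<omega> by blast
    then show "\<omega> \<in> (\<Union>p\<in>R N. A p n)"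
      using \<omega> by (auto simp: close_def A_def not_le ennreal_less_iff)
  qed
  then have le: "outer_measure_of M {\<omega> \<in> space M. \<epsilon> < V (\<phi>h n \<omega>) (qh n \<omega>)} \<le> outer_measure_of M (\<Union>p\<in>R N. A p n)" for n
    by (rule outer_measure_of_mono)
  show "(\<lambda>n. outer_measure_of M {\<omega> \<in> space M. \<epsilon> < V (\<phi>h n \<omega>) (qh n \<omega>)}) \<longlonglongrightarrow> 0"
    by (rule tendsto_sandwich[OF _ _ tendsto_const lim]) (simp_all add: le)
qed

theorem theorem5p3:
  fixes M :: "'w measure"
    and \<phi> :: "real \<Rightarrow> ereal" and q :: real
    and X :: "nat \<Rightarrow> nat \<Rightarrow> 'w \<Rightarrow> ereal"
    and L :: "nat \<Rightarrow> nat \<Rightarrow> 'w \<Rightarrow> real" and R :: "nat \<Rightarrow> nat \<Rightarrow> 'w \<Rightarrow> ereal"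
    and \<phi>h :: "nat \<Rightarrow> 'w \<Rightarrow> real \<Rightarrow> ereal" and qh :: "nat \<Rightarrow> 'w \<Rightarrow> real"
    and a b :: ereal
  defines "f \<equiv> dens \<phi>" and "fh \<equiv> \<lambda>n \<omega>. dens (\<phi>h n \<omega>)"
    and "F \<equiv> dist_fun \<phi> q" and "Fh \<equiv> \<lambda>n \<omega>. dist_fun (\<phi>h n \<omega>) (qh n \<omega>)"
  assumes prob: "prob_space M"
    and theta: "(\<phi>, q) \<in> Theta"
    and X_meas: "\<And>n i. i < n \<Longrightarrow> X n i \<in> borel_measurable M"
    and X_distr: "\<And>n i B. i < n \<Longrightarrow> B \<in> sets borel \<Longrightarrow> B \<subseteq> {-\<infinity><..} \<Longrightarrow>
                   measure M {\<omega>\<in>space M. X n i \<omega> \<in> B} = Pr \<phi> q B"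
    and L_meas: "\<And>n i. i < n \<Longrightarrow> L n i \<in> borel_measurable M"
    and R_meas: "\<And>n i. i < n \<Longrightarrow> R n i \<in> borel_measurable M"
    and obs: "\<And>n i \<omega>. i < n \<Longrightarrow> \<omega> \<in> space M \<Longrightarrow>
                (ereal (L n i \<omega>) < R n i \<omega> \<and> X n i \<omega> \<in> {ereal (L n i \<omega>)<..R n i \<omega>}) \<or>
                (R n i \<omega> = ereal (L n i \<omega>) \<and> X n i \<omega> = ereal (L n i \<omega>))"
    and est_theta: "\<And>n \<omega>. \<omega> \<in> space M \<Longrightarrow> (\<phi>h n \<omega>, qh n \<omega>) \<in> Theta"
    and est_meas_phi: "\<And>n x. (\<lambda>\<omega>. \<phi>h n \<omega> x) \<in> borel_measurable M"
    and est_meas_q: "\<And>n. qh n \<in> borel_measurable M"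
    and est_MLE: "\<forall>\<^sub>F n in sequentially. AE \<omega> in M.
                    is_MLE n (\<lambda>i. L n i \<omega>) (\<lambda>i. R n i \<omega>) (\<phi>h n \<omega>) (qh n \<omega>)"
    and ab: "a < b"
    and mass: "Lim (at_left b) F > F a"
    and Fh_conv: "\<And>x. a < x \<Longrightarrow> x < b \<Longrightarrow> to_prob M (\<lambda>n \<omega>. Fh n \<omega> x) (F x)"
  shows "(\<forall>\<delta>>0.
            to_prob_zero M (\<lambda>n \<omega>. SUP x\<in>C_set f a b \<delta>. ennreal (pos_part (fh n \<omega> x - f x))) \<and>
            to_prob_zero M (\<lambda>n \<omega>. SUP x\<in>D_set f a b \<delta>. ennreal \<bar>fh n \<omega> x - f x\<bar>)) \<and>
         to_prob M (\<lambda>n \<omega>. LBINT x=a..b. \<bar>fh n \<omega> x - f x\<bar>) 0 \<and>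
         to_prob_zero M (\<lambda>n \<omega>. SUP x\<in>{a..b}. ennreal \<bar>Fh n \<omega> x - F x\<bar>) \<and>
         (b = \<infinity> \<longrightarrow> to_prob M qh q) \<and>
         (\<forall>\<beta>::real. b = ereal \<beta> \<longrightarrow>
            le_op1 M qh (1 - F b) \<and>
            (f \<beta> = 0 \<longrightarrow> to_prob M qh (1 - F b)) \<and>
            (f \<beta> > 0 \<and> left_deriv \<phi> \<beta> < 0 \<longrightarrow>
               ge_op1 M qh (1 - F b - real_of_ereal (ereal (f \<beta>) / \<bar>left_deriv \<phi> \<beta>\<bar>))))"
proof -
  note unf = f_def fh_def F_def Fh_def
  have seq: "Theta_seq \<phi> q \<psi> r a b"
    if "\<And>k. (\<psi> k, r k) \<in> Theta"
      "\<And>x. a < ereal x \<Longrightarrow> ereal x < b \<Longrightarrow>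
        (\<lambda>k. dist_fun (\<psi> k) (r k) (ereal x)) \<longlonglongrightarrow> dist_fun \<phi> q (ereal x)" for \<psi> r
    using that theta ab mass unfolding unf by unfold_locales
  have conv: "to_prob M (\<lambda>n \<omega>. dist_fun (\<phi>h n \<omega>) (qh n \<omega>) (ereal x)) (dist_fun \<phi> q (ereal x))"
    if "a < ereal x" "ereal x < b" for x
    using Fh_conv[OF that] unfolding unf .
  \<comment> \<open>Confines the randomness to this statement: each claim of the theorem is an
    instance for a suitable functional \<open>V\<close> of the parameters.\<close>
  have transfer: "to_prob_zero M (\<lambda>n \<omega>. V (\<phi>h n \<omega>) (qh n \<omega>))"
    if V: "\<And>\<psi> r \<eta>. Theta_seq \<phi> q \<psi> r a b \<Longrightarrow> 0 < \<eta> \<Longrightarrow> \<forall>\<^sub>F k in sequentially. V (\<psi> k) (r k) \<le> ennreal \<eta>"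
    for V :: "(real \<Rightarrow> ereal) \<Rightarrow> real \<Rightarrow> ennreal"
  proof (rule to_prob_zero_if_sequential[OF theta est_theta conv])
    show "\<forall>\<^sub>F k in sequentially. V (\<psi> k) (r k) \<le> ennreal \<eta>"
      if "\<And>k. (\<psi> k, r k) \<in> Theta"
        "\<And>x. a < ereal x \<Longrightarrow> ereal x < b \<Longrightarrow>
          (\<lambda>k. dist_fun (\<psi> k) (r k) (ereal x)) \<longlonglongrightarrow> dist_fun \<phi> q (ereal x)"
        "0 < \<eta>" for \<psi> r \<eta>
      by (rule V[OF seq[OF that(1,2)] that(3)])
  qed
  have "to_prob_zero M (\<lambda>n \<omega>. SUP x\<in>C_set (dens \<phi>) a b \<delta>. ennreal (pos_part (dens (\<phi>h n \<omega>) x - dens \<phi> x)))"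
    if \<delta>: "0 < \<delta>" for \<delta>
  proof (rule transfer)
    fix \<psi> r and \<eta> :: real assume s: "Theta_seq \<phi> q \<psi> r a b" and \<eta>: "0 < \<eta>"
    interpret Theta_seq \<phi> q \<psi> r a b by (rule s)
    show "\<forall>\<^sub>F k in sequentially.
        (SUP x\<in>C_set (dens \<phi>) a b \<delta>. ennreal (pos_part (dens (\<psi> k) x - dens \<phi> x))) \<le> ennreal \<eta>"
      using eventually_C_set[OF \<eta> \<delta>]
    proof eventually_elim
      case (elim k)
      show ?case by (rule SUP_least, rule ennreal_leI) (use elim \<eta> in \<open>auto simp: pos_part_def algebra_simps\<close>)
    qed
  qed
  moreover have "to_prob_zero M (\<lambda>n \<omega>. SUP x\<in>D_set (dens \<phi>) a b \<delta>. ennreal \<bar>dens (\<phi>h n \<omega>) x - dens \<phi> x\<bar>)"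
    if \<delta>: "0 < \<delta>" for \<delta>
  proof (rule transfer)
    fix \<psi> r and \<eta> :: real assume s: "Theta_seq \<phi> q \<psi> r a b" and \<eta>: "0 < \<eta>"
    interpret Theta_seq \<phi> q \<psi> r a b by (rule s)
    show "\<forall>\<^sub>F k in sequentially.
        (SUP x\<in>D_set (dens \<phi>) a b \<delta>. ennreal \<bar>dens (\<psi> k) x - dens \<phi> x\<bar>) \<le> ennreal \<eta>"
      using eventually_D_set[OF \<eta> \<delta>]
      by eventually_elim (auto intro!: SUP_least ennreal_leI)
  qed
  moreover have "to_prob M (\<lambda>n \<omega>. LBINT x=a..b. \<bar>dens (\<phi>h n \<omega>) x - dens \<phi> x\<bar>) 0"
    unfolding to_prob_def
  proof (rule transfer)
    fix \<psi> r and \<eta> :: real assume s: "Theta_seq \<phi> q \<psi> r a b" and \<eta>: "0 < \<eta>"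
    interpret Theta_seq \<phi> q \<psi> r a b by (rule s)
    show "\<forall>\<^sub>F k in sequentially.
        ennreal \<bar>(LBINT x=a..b. \<bar>dens (\<psi> k) x - dens \<phi> x\<bar>) - 0\<bar> \<le> ennreal \<eta>"
      using eventually_interval_L1[OF \<eta>]
      by eventually_elim (simp add: ennreal_leI)
  qed
  moreover have "to_prob_zero M (\<lambda>n \<omega>. SUP x\<in>{a..b}. ennreal \<bar>dist_fun (\<phi>h n \<omega>) (qh n \<omega>) x - dist_fun \<phi> q x\<bar>)"
  proof (rule transfer)
    fix \<psi> r and \<eta> :: real assume s: "Theta_seq \<phi> q \<psi> r a b" and \<eta>: "0 < \<eta>"
    interpret Theta_seq \<phi> q \<psi> r a b by (rule s)
    show "\<forall>\<^sub>F k in sequentially.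
        (SUP x\<in>{a..b}. ennreal \<bar>dist_fun (\<psi> k) (r k) x - dist_fun \<phi> q x\<bar>) \<le> ennreal \<eta>"
      using eventually_dist_fun[OF \<eta>]
      by eventually_elim (auto intro!: SUP_least ennreal_leI)
  qed
  moreover have "to_prob M qh q" if b: "b = \<infinity>"
    unfolding to_prob_def
  proof (rule transfer)
    fix \<psi> r and \<eta> :: real assume s: "Theta_seq \<phi> q \<psi> r a b" and \<eta>: "0 < \<eta>"
    interpret Theta_seq \<phi> q \<psi> r a b by (rule s)
    show "\<forall>\<^sub>F k in sequentially. ennreal \<bar>r k - q\<bar> \<le> ennreal \<eta>"
      using eventually_q_infinite[OF b \<eta>] by eventually_elim (rule ennreal_leI)
  qed
  moreover have "le_op1 M qh (1 - dist_fun \<phi> q b)" if b: "b = ereal \<beta>" for \<beta>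
    unfolding le_op1_def
  proof (rule transfer)
    fix \<psi> r and \<eta> :: real assume s: "Theta_seq \<phi> q \<psi> r a b" and \<eta>: "0 < \<eta>"
    interpret Theta_seq \<phi> q \<psi> r a b by (rule s)
    show "\<forall>\<^sub>F k in sequentially. ennreal (pos_part (r k - (1 - dist_fun \<phi> q b))) \<le> ennreal \<eta>"
      using eventually_q_le[OF b \<eta>]
    proof eventually_elim
      case (elim k)
      show ?case by (rule ennreal_leI) (use elim \<eta> in \<open>simp add: pos_part_def\<close>)
    qed
  qed
  moreover have "to_prob M qh (1 - dist_fun \<phi> q b)" if b: "b = ereal \<beta>" and f0: "dens \<phi> \<beta> = 0" for \<beta>
    unfolding to_prob_def
  proof (rule transfer)
    fix \<psi> r and \<eta> :: real assume s: "Theta_seq \<phi> q \<psi> r a b" and \<eta>: "0 < \<eta>"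
    interpret Theta_seq \<phi> q \<psi> r a b by (rule s)
    show "\<forall>\<^sub>F k in sequentially. ennreal \<bar>r k - (1 - dist_fun \<phi> q b)\<bar> \<le> ennreal \<eta>"
      using eventually_q_eq[OF b f0 \<eta>] by eventually_elim (rule ennreal_leI)
  qed
  moreover have "ge_op1 M qh (1 - dist_fun \<phi> q b - real_of_ereal (ereal (dens \<phi> \<beta>) / \<bar>left_deriv \<phi> \<beta>\<bar>))"
    if b: "b = ereal \<beta>" and fb: "0 < dens \<phi> \<beta>" and D: "left_deriv \<phi> \<beta> < 0" for \<beta>
    unfolding ge_op1_def
  proof (rule transfer)
    fix \<psi> r and \<eta> :: real assume s: "Theta_seq \<phi> q \<psi> r a b" and \<eta>: "0 < \<eta>"
    interpret Theta_seq \<phi> q \<psi> r a b by (rule s)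
    show "\<forall>\<^sub>F k in sequentially. ennreal (pos_part (1 - dist_fun \<phi> q b -
        real_of_ereal (ereal (dens \<phi> \<beta>) / \<bar>left_deriv \<phi> \<beta>\<bar>) - r k)) \<le> ennreal \<eta>"
      using eventually_q_ge[OF b fb D \<eta>]
    proof eventually_elim
      case (elim k)
      show ?case by (rule ennreal_leI) (use elim \<eta> in \<open>simp add: pos_part_def\<close>)
    qed
  qed
  ultimately show ?thesis unfolding unf by blast
qed

end
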